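(* The following two assertions are equivalent. (A) Every polynomial map $f: \mathbb{C}^2 \to \mathbb{C}^2$ whose Jacobian determinant is a nonzero constant is bijective and has a polynomial inverse. (B) For every polynomial map $f: \mathbb{C}^2 \to \mathbb{C}^2$ whose Jacobian determinant is a nonzero constant, and every cofinite subset $\Omega \subseteq \mathbb{C}^2$ with $f(\Omega) = \Omega$, the restriction $f|_{\Omega}$ is injective.
   Context: A subset of $\mathbb{C}^2$ is cofinite if its complement in $\mathbb{C}^2$ is finite. *)

theory Defs
  imports "HOL-Analysis.Analysis"
begin

definition poly2 :: "(complex \<times> complex \<Rightarrow> complex) \<Rightarrow> bool" where
  "poly2 p \<longleftrightarrow> (\<exists>(n::nat) (c :: nat \<Rightarrow> nat \<Rightarrow> complex).
      \<forall>x y. p (x, y) = (\<Sum>i\<le>n. \<Sum>j\<le>n. c i j * x ^ i * y ^ j))"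

definition poly_map2 :: "(complex \<times> complex \<Rightarrow> complex \<times> complex) \<Rightarrow> bool" where
  "poly_map2 f \<longleftrightarrow> poly2 (\<lambda>z. fst (f z)) \<and> poly2 (\<lambda>z. snd (f z))"

definition jacobian_det2 :: "(complex \<times> complex \<Rightarrow> complex \<times> complex) \<Rightarrow> complex \<Rightarrow> complex \<Rightarrow> complex" where
  "jacobian_det2 f x y =
     deriv (\<lambda>t. fst (f (t, y))) x * deriv (\<lambda>t. snd (f (x, t))) y
   - deriv (\<lambda>t. fst (f (x, t))) y * deriv (\<lambda>t. snd (f (t, y))) x"

definition const_nonzero_jacobian2 :: "(complex \<times> complex \<Rightarrow> complex \<times> complex) \<Rightarrow> bool" where
  "const_nonzero_jacobian2 f \<longleftrightarrow> (\<exists>c. c \<noteq> 0 \<and> (\<forall>x y. jacobian_det2 f x y = c))"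

definition cofinite2 :: "(complex \<times> complex) set \<Rightarrow> bool" where
  "cofinite2 \<Omega> \<longleftrightarrow> finite (UNIV - \<Omega>)"

end

theory Submission
  imports Defs
    "HOL-Complex_Analysis.Complex_Analysis"
    "HOL-Computational_Algebra.Field_as_Ring"
    "HOL-Computational_Algebra.Fundamental_Theorem_Algebra"
    "Subresultants.Subresultant_Gcd"
begin

text \<open>
  Let \<open>f = (p, q)\<close> have nonzero constant Jacobian. After a generic shear both components are monic
  in \<open>y\<close> up to a constant, so the resultant \<open>R(x; u, v)\<close> of \<open>p - u\<close> and \<open>q - v\<close> with respect to \<open>y\<close>
  vanishes at \<open>x\<close> iff \<open>x\<close> is the first coordinate of a point over \<open>(u, v)\<close>. As the fibres of \<open>f\<close> are
  discrete, a point is omitted by \<open>f\<close> iff all coefficients of \<open>R\<close> of positive degree in \<open>x\<close> vanish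
  there. Their greatest common divisor \<open>h\<close> has no zero on the image, so \<open>h \<circ> f\<close>, and then \<open>h\<close>, is
  constant: \<open>f\<close> omits only finitely many points.

  If \<open>f\<close> is injective, the coordinates of its inverse are holomorphic and algebraic over the
  polynomials (by \<open>R\<close>), hence polynomial on all but finitely many lines by Liouville's theorem, hence
  polynomial. If \<open>f\<close> is not injective, let \<open>E\<close> be its finite set of omitted values and choose a set \<open>S\<close>
  of equally many points, each sharing its image with a point outside \<open>S\<close>. For an automorphism \<open>\<phi>\<close>
  carrying \<open>E\<close> to \<open>S\<close>, the map \<open>\<phi> \<circ> f\<close> sends the complement of \<open>S\<close> onto itself, but not injectively.
\<close>

section \<open>Polynomial functions in two variables\<close>

text \<open>The outer variable is \<open>y\<close> and the coefficients are polynomials in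
  \<open>x\<close>, so \<open>degree\<close>, \<open>lead_coeff\<close> and \<open>resultant\<close>
  refer to \<open>y\<close>.\<close>

definition bipoly :: "complex poly poly \<Rightarrow> complex \<Rightarrow> complex \<Rightarrow> complex" where
  "bipoly P x y = poly (poly P [:y:]) x"

lemma bipoly_simps [simp]:
  "bipoly 0 x y = 0"
  "bipoly 1 x y = 1"
  "bipoly [:a:] x y = poly a x"
  "bipoly (pCons a P) x y = poly a x + y * bipoly P x y"
  "bipoly (P + Q) x y = bipoly P x y + bipoly Q x y"
  "bipoly (P - Q) x y = bipoly P x y - bipoly Q x y"
  "bipoly (P * Q) x y = bipoly P x y * bipoly Q x y"
  "bipoly (P ^ n) x y = bipoly P x y ^ n"
  "bipoly (Polynomial.smult a P) x y = poly a x * bipoly P x y"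
  by (simp_all add: bipoly_def)

lemma bipoly_sum: "bipoly (sum P A) x y = (\<Sum>i\<in>A. bipoly (P i) x y)"
  by (simp add: bipoly_def poly_sum)

lemma bipoly_altdef:
  "bipoly P x y = (\<Sum>j\<le>degree P. \<Sum>i\<le>degree (coeff P j). coeff (coeff P j) i * x ^ i * y ^ j)"
proof -
  have "bipoly P x y = (\<Sum>j\<le>degree P. poly (coeff P j) x * y ^ j)"
    by (simp add: bipoly_def poly_altdef[of P] poly_sum)
  then show ?thesis
    by (simp add: poly_altdef sum_distrib_right)
qed

text \<open>Fixing \<open>x\<close> first leaves a polynomial in \<open>y\<close> over the complex
  numbers, the form in which resultants are specialised.\<close>

lemma poly_map_poly_eval: "poly (map_poly (\<lambda>c. poly c x) P) y = bipoly P x y"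
  by (induction P) (simp_all add: map_poly_pCons bipoly_def)

lemma poly2_iff_bipoly: "poly2 p \<longleftrightarrow> (\<exists>P. \<forall>x y. p (x, y) = bipoly P x y)"
proof
  assume "poly2 p"
  then obtain n c where p: "\<And>x y. p (x, y) = (\<Sum>i\<le>n. \<Sum>j\<le>n. c i j * x ^ i * y ^ j)"
    unfolding poly2_def by blast
  have "p (x, y) = bipoly (\<Sum>i\<le>n. \<Sum>j\<le>n. [:[:c i j:]:] * [:[:0, 1:]:] ^ i * [:0, 1:] ^ j) x y" for x y
    by (simp add: p bipoly_sum mult.assoc)
  then show "\<exists>P. \<forall>x y. p (x, y) = bipoly P x y" by blast
next
  assume "\<exists>P. \<forall>x y. p (x, y) = bipoly P x y"
  then obtain P where P: "\<And>x y. p (x, y) = bipoly P x y" by blast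
  \<comment> \<open>One bound for the degrees in both variables, as \<open>poly2\<close> sums over a
    square of exponents.\<close>
  define n where "n = Max (insert (degree P) ((\<lambda>j. degree (coeff P j)) ` {..degree P}))"
  define c where "c = (\<lambda>i j. coeff (coeff P j) i)"
  have n: "degree P \<le> n" "\<And>j. j \<le> degree P \<Longrightarrow> degree (coeff P j) \<le> n"
    unfolding n_def by (auto intro: Max_ge simp del: Max_insert)
  have "p (x, y) = (\<Sum>i\<le>n. \<Sum>j\<le>n. c i j * x ^ i * y ^ j)" for x y
  proof -
    have "p (x, y) = (\<Sum>j\<le>degree P. \<Sum>i\<le>n. c i j * x ^ i * y ^ j)"
      unfolding P bipoly_altdef c_def using n
      by (intro sum.cong refl sum.mono_neutral_left) (auto simp: coeff_eq_0)
    also have "\<dots> = (\<Sum>j\<le>n. \<Sum>i\<le>n. c i j * x ^ i * y ^ j)"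
      unfolding c_def using n by (intro sum.mono_neutral_left) (auto simp: coeff_eq_0)
    also have "\<dots> = (\<Sum>i\<le>n. \<Sum>j\<le>n. c i j * x ^ i * y ^ j)"
      by (rule sum.swap)
    finally show ?thesis .
  qed
  then show "poly2 p" unfolding poly2_def by blast
qed

section \<open>Closure properties of polynomial functions\<close>

lemma poly2_bipoly [intro, simp]: "poly2 (\<lambda>z. bipoly P (fst z) (snd z))"
  unfolding poly2_iff_bipoly by auto

lemma poly2_const [intro, simp]: "poly2 (\<lambda>_. c)"
  unfolding poly2_iff_bipoly by (intro exI[of _ "[:[:c:]:]"]) simp

lemma poly2_fst [intro, simp]: "poly2 fst"
  unfolding poly2_iff_bipoly by (intro exI[of _ "[:[:0,1:]:]"]) simp

lemma poly2_snd [intro, simp]: "poly2 snd"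
  unfolding poly2_iff_bipoly by (intro exI[of _ "[:0,1:]"]) simp

lemma poly2_add [intro]:
  assumes "poly2 p" "poly2 q" shows "poly2 (\<lambda>z. p z + q z)"
proof -
  obtain P Q where "\<forall>x y. p (x, y) = bipoly P x y" "\<forall>x y. q (x, y) = bipoly Q x y"
    using assms poly2_iff_bipoly by metis
  then show ?thesis
    unfolding poly2_iff_bipoly by (intro exI[of _ "P + Q"]) simp
qed

lemma poly2_mult [intro]:
  assumes "poly2 p" "poly2 q" shows "poly2 (\<lambda>z. p z * q z)"
proof -
  obtain P Q where "\<forall>x y. p (x, y) = bipoly P x y" "\<forall>x y. q (x, y) = bipoly Q x y"
    using assms poly2_iff_bipoly by metis
  then show ?thesis
    unfolding poly2_iff_bipoly by (intro exI[of _ "P * Q"]) simp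
qed

lemma poly2_diff [intro]:
  assumes "poly2 p" "poly2 q" shows "poly2 (\<lambda>z. p z - q z)"
  using poly2_add[OF assms(1) poly2_mult[OF poly2_const[of "-1"] assms(2)]] by simp

lemma poly2_poly [intro]: "poly2 p \<Longrightarrow> poly2 (\<lambda>z. poly a (p z))"
  by (induction a) auto

lemma poly2_compose:
  assumes "poly2 h" "poly2 p" "poly2 q" shows "poly2 (\<lambda>z. h (p z, q z))"
proof -
  obtain H where H: "\<forall>x y. h (x, y) = bipoly H x y"
    using assms poly2_iff_bipoly by metis
  have "poly2 (\<lambda>z. bipoly H (p z) (q z))"
    by (induction H) (use assms in auto)
  then show ?thesis using H by simp
qed

lemma poly_map2_compose:
  assumes "poly_map2 f" "poly_map2 g" shows "poly_map2 (\<lambda>z. f (g z))"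
  using assms poly2_compose[of "\<lambda>z. fst (f z)" "\<lambda>z. fst (g z)" "\<lambda>z. snd (g z)"]
    poly2_compose[of "\<lambda>z. snd (f z)" "\<lambda>z. fst (g z)" "\<lambda>z. snd (g z)"]
  unfolding poly_map2_def by simp

text \<open>An open set contains a box with two infinite sides. For each \<open>y\<close> in one
  side, \<open>poly P [:y:]\<close> has infinitely many roots and vanishes; so \<open>P\<close>
  itself has infinitely many roots \<open>[:y:]\<close> in its coefficient ring.\<close>

lemma bipoly_eq_0_open:
  assumes "open U" "U \<noteq> {}" "\<And>x y. (x, y) \<in> U \<Longrightarrow> bipoly P x y = 0"
  shows "P = 0"
proof -
  obtain a b where "(a, b) \<in> U" using assms(2) by auto
  then obtain A B where AB: "open A" "open B" "a \<in> A" "b \<in> B" "A \<times> B \<subseteq> U"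
    using assms(1) by (metis SigmaE2 mem_Sigma_iff open_prod_elim)
  have inf: "infinite A" "infinite B"
    using AB finite_imp_not_open by blast+
  have "poly P [:y:] = 0" if "y \<in> B" for y
  proof (rule ccontr)
    assume "poly P [:y:] \<noteq> 0"
    then have "finite {x. poly (poly P [:y:]) x = 0}" by (rule poly_roots_finite)
    moreover have "A \<subseteq> {x. poly (poly P [:y:]) x = 0}"
      using AB that assms(3) unfolding bipoly_def by auto
    ultimately show False using inf finite_subset by blast
  qed
  then have sub: "(\<lambda>y. [:y:]) ` B \<subseteq> {c. poly P c = 0}" by auto
  have "infinite ((\<lambda>y. [:y:]) ` B)"
    using inf by (subst finite_image_iff) (auto simp: inj_on_def)
  then show "P = 0" using sub poly_roots_finite finite_subset by blast
qed

text \<open>Identity theorem, used to spread identities known only on an open set, such as the image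
  of \<open>f\<close>, to the whole plane.\<close>

lemma poly2_eq_open:
  assumes "poly2 p" "poly2 q" "open U" "U \<noteq> {}" "\<And>z. z \<in> U \<Longrightarrow> p z = q z"
  shows "p z = q z"
proof -
  obtain P where P: "\<And>x y. p (x, y) - q (x, y) = bipoly P x y"
    using poly2_diff[OF assms(1,2)] poly2_iff_bipoly by auto
  have "P = 0"
    using bipoly_eq_0_open[OF assms(3,4)] P assms(5) by (metis right_minus_eq)
  then show ?thesis using P by (cases z) simp
qed

lemma poly2_has_derivative:
  assumes "poly2 p"
  shows "(p has_derivative
      (\<lambda>h. deriv (\<lambda>t. p (t, y)) x * fst h + deriv (\<lambda>t. p (x, t)) y * snd h)) (at (x, y))"
proof -
  obtain P where P: "\<And>x y. p (x, y) = bipoly P x y"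
    using assms poly2_iff_bipoly by metis
  have "\<exists>a b. ((\<lambda>z. bipoly P (fst z) (snd z)) has_derivative (\<lambda>h. a * fst h + b * snd h)) (at (x, y))"
  proof (induction P)
    case 0
    show ?case by (rule exI[of _ 0], rule exI[of _ 0]) simp
  next
    case (pCons c P)
    then obtain a b where
      "((\<lambda>z. bipoly P (fst z) (snd z)) has_derivative (\<lambda>h. a * fst h + b * snd h)) (at (x, y))" by blast
    note [derivative_intros] = this
    have "((\<lambda>z. poly c z) has_derivative (\<lambda>h. poly (pderiv c) x * h)) (at x)"
      using poly_DERIV has_field_derivative_def by blast
    then have [derivative_intros]:
      "((\<lambda>z. poly c (fst z)) has_derivative (\<lambda>h. poly (pderiv c) x * fst h)) (at (x, y))"
      using has_derivative_compose[OF has_derivative_fst[OF has_derivative_ident], where x = "(x, y)" and g = "poly c"] by simp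
    show ?case
      by (rule exI[of _ "poly (pderiv c) x + y * a"], rule exI[of _ "bipoly P x y + y * b"])
        (auto intro!: derivative_eq_intros simp: algebra_simps)
  qed
  moreover have "p = (\<lambda>z. bipoly P (fst z) (snd z))" using P by auto
  ultimately obtain a b where D0: "(p has_derivative (\<lambda>h. a * fst h + b * snd h)) (at (x, y))" by auto
  \<comment> \<open>Restriction to the two coordinate lines identifies \<open>a\<close> and
    \<open>b\<close> with the partial derivatives.\<close>
  have "((\<lambda>t. p (t, y)) has_derivative (\<lambda>h. a * h)) (at x)"
    using has_derivative_compose[where f = "\<lambda>t. (t, y)" and f' = "\<lambda>h. (h, 0)" and x = x and s = UNIV, OF _ D0]
    by (simp add: has_derivative_Pair)
  moreover have "((\<lambda>t. p (x, t)) has_derivative (\<lambda>h. b * h)) (at y)"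
    using has_derivative_compose[where f = "\<lambda>t. (x, t)" and f' = "\<lambda>h. (0, h)" and x = y and s = UNIV, OF _ D0]
    by (simp add: has_derivative_Pair)
  ultimately have "deriv (\<lambda>t. p (t, y)) x = a" "deriv (\<lambda>t. p (x, t)) y = b"
    by (auto intro!: DERIV_imp_deriv simp: has_field_derivative_def)
  then show ?thesis using D0 by simp
qed

lemma poly2_partial_derivatives:
  assumes "poly2 p"
  shows "((\<lambda>t. p (t, y)) has_field_derivative deriv (\<lambda>t. p (t, y)) x) (at x)"
    and "((\<lambda>t. p (x, t)) has_field_derivative deriv (\<lambda>t. p (x, t)) y) (at y)"
proof -
  let ?a = "deriv (\<lambda>t. p (t, y)) x" and ?b = "deriv (\<lambda>t. p (x, t)) y"
  note D = poly2_has_derivative[OF assms, of y x]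
  show "((\<lambda>t. p (t, y)) has_field_derivative ?a) (at x)"
    unfolding has_field_derivative_def
    using has_derivative_compose[where f = "\<lambda>t. (t, y)" and f' = "\<lambda>h. (h, 0)" and x = x and s = UNIV, OF _ D]
    by (simp add: has_derivative_Pair)
  show "((\<lambda>t. p (x, t)) has_field_derivative ?b) (at y)"
    unfolding has_field_derivative_def
    using has_derivative_compose[where f = "\<lambda>t. (x, t)" and f' = "\<lambda>h. (0, h)" and x = y and s = UNIV, OF _ D]
    by (simp add: has_derivative_Pair)
qed

lemma poly_map2_continuous: "poly_map2 f \<Longrightarrow> continuous_on S f"
proof -
  assume f: "poly_map2 f"
  have "isCont (\<lambda>z. fst (f z)) z" "isCont (\<lambda>z. snd (f z)) z" for z
    using poly2_has_derivative[of _ "snd z" "fst z"] f has_derivative_continuous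
    unfolding poly_map2_def by force+
  then have "isCont f z" for z
    using continuous_Pair[of "at z" "\<lambda>z. fst (f z)" "\<lambda>z. snd (f z)"] by simp
  then show ?thesis by (simp add: continuous_at_imp_continuous_on)
qed

section \<open>Maps with constant nonzero Jacobian\<close>

locale keller_map =
  fixes f :: "complex \<times> complex \<Rightarrow> complex \<times> complex"
  assumes poly_map: "poly_map2 f" and jacobian: "const_nonzero_jacobian2 f"
begin

text \<open>Cramer's rule inverts the Jacobian matrix. The explicit form of \<open>g'\<close>
  records that it is complex linear, which later makes the inverse of \<open>f\<close> holomorphic
  along coordinate lines.\<close>

lemma derivative:
  obtains f' g' :: "complex \<times> complex \<Rightarrow> complex \<times> complex" and a b c d
  where "(f has_derivative f') (at z)" "bounded_linear g'" "f' \<circ> g' = id" "g' \<circ> f' = id"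
    "\<And>h. g' h = (a * fst h + b * snd h, c * fst h + d * snd h)"
proof -
  obtain x y where z: "z = (x, y)" by (cases z)
  define a b c d where "a = deriv (\<lambda>t. fst (f (t, y))) x" "b = deriv (\<lambda>t. fst (f (x, t))) y"
    "c = deriv (\<lambda>t. snd (f (t, y))) x" "d = deriv (\<lambda>t. snd (f (x, t))) y"
  note abcd = this
  define J where "J = a * d - b * c"
  have J: "J \<noteq> 0"
    using jacobian unfolding const_nonzero_jacobian2_def jacobian_det2_def J_def abcd by metis
  define f' where "f' = (\<lambda>h::complex\<times>complex. (a * fst h + b * snd h, c * fst h + d * snd h))"
  define g' where "g' = (\<lambda>h::complex\<times>complex. ((d/J) * fst h + (-b/J) * snd h, (-c/J) * fst h + (a/J) * snd h))"
  have "((\<lambda>z. (fst (f z), snd (f z))) has_derivative f') (at z)"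
    unfolding z f'_def abcd using poly_map unfolding poly_map2_def
    by (intro has_derivative_Pair poly2_has_derivative) auto
  then have 1: "(f has_derivative f') (at z)" by simp
  have 2: "bounded_linear g'"
    unfolding g'_def
    by (intro bounded_linear_Pair bounded_linear_add bounded_linear_const_mult bounded_linear_fst bounded_linear_snd)
  have 3: "f' \<circ> g' = id" "g' \<circ> f' = id"
    using J unfolding f'_def g'_def by (auto simp: fun_eq_iff field_simps) (auto simp: J_def algebra_simps)
  show ?thesis
    using that[OF 1 2 3 g'_def[THEN fun_cong]] .
qed

text \<open>The derivative has a right inverse at every point, so Sussmann's open mapping theorem
  applies.\<close>

lemma open_map: 
  assumes "open U" shows "open (f ` U)"
proof -
  have "f z \<in> interior (f ` U)" if "z \<in> U" for z
  proof -
    obtain f' g' where "(f has_derivative f') (at z)" "bounded_linear g'" "f' \<circ> g' = id"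
      by (rule derivative)
    from sussmann_open_mapping[OF open_UNIV poly_map2_continuous[OF poly_map] _ this, of U] show ?thesis
      using that assms by (auto simp: interior_open)
  qed
  then show ?thesis
    by (metis image_subset_iff interior_subset open_interior subset_antisym)
qed

text \<open>An accumulation point of the fibre lies in it by closedness, but an invertible
  derivative keeps nearby points off the fibre. A set without accumulation points in the plane is
  countable.\<close>

lemma countable_fibre: "countable (f -` {w})"
proof -
  have "\<not> z islimpt (f -` {w})" for z
  proof
    assume lim: "z islimpt (f -` {w})"
    have "closed (f -` {w})"
      using poly_map poly_map2_continuous continuous_closed_vimage closed_singleton
      by (metis continuous_on_closed_vimage closed_UNIV inf_top.right_neutral)
    then have fz: "f z = w" using lim closed_limpt by fastforce
    obtain f' g' where D: "(f has_derivative f') (at z)" "bounded_linear g'" "g' \<circ> f' = id"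
      by (rule derivative)
    obtain B where B: "B > 0" "\<And>h. norm (g' h) \<le> norm h * B"
      using bounded_linear.pos_bounded[OF D(2)] by blast
    have low: "norm h \<le> norm (f' h) * B" for h
      using B(2)[of "f' h"] D(3) by (metis comp_apply id_apply)
    \<comment> \<open>The derivative stretches by at least \<open>1 / B\<close>; an error of half
      that size cannot cancel it.\<close>
    have "1 / (2 * B) > 0" using B by simp
    then obtain e where e: "e > 0"
      "\<And>y. norm (y - z) < e \<Longrightarrow> norm (f y - f z - f' (y - z)) \<le> 1 / (2 * B) * norm (y - z)"
      using D(1) unfolding has_derivative_at_alt by blast
    obtain y where y: "f y = w" "y \<noteq> z" "norm (y - z) < e"
      using lim e(1) unfolding islimpt_approachable by (auto simp: dist_norm)
    have "norm (f' (y - z)) \<le> 1 / (2 * B) * norm (y - z)"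
      using e(2)[OF y(3)] y fz by simp
    then have "norm (f' (y - z)) * B \<le> norm (y - z) / 2"
      using B(1) by (simp add: field_simps)
    then have "norm (y - z) \<le> norm (y - z) / 2"
      using low[of "y - z"] by linarith
    then show False using y(2) by simp
  qed
  then have "(f -` {w}) sparse_in UNIV"
    by (simp add: sparse_in_open)
  then show ?thesis using sparse_imp_countable[of UNIV "f -` {w}"] by simp
qed

text \<open>The parallel lines indexed by \<open>x\<close> are disjoint and uncountable in number,
  while the fibre is countable. This keeps the eliminant from vanishing identically in
  \<open>x\<close>.\<close>

lemma some_line_avoids_fibre:
  "\<exists>x. \<forall>y. f (x + t * y, y) \<noteq> w"
proof (rule ccontr)
  assume "\<not> ?thesis"
  then obtain Y where Y: "\<And>x. f (x + t * Y x, Y x) = w" by metis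
  then have "range (\<lambda>x. (x + t * Y x, Y x)) \<subseteq> f -` {w}" by auto
  then have "countable (range (\<lambda>x. (x + t * Y x, Y x)))"
    using countable_fibre countable_subset by blast
  moreover have "inj (\<lambda>x. (x + t * Y x, Y x))" by (auto simp: inj_def)
  ultimately show False
    using uncountable_UNIV_complex countable_image_inj_on by blast
qed

end

section \<open>Common zeros and elimination\<close>

lemma degree_nonzero_of_root:
  fixes p :: "complex poly"
  assumes "p \<noteq> 0" "poly p y = 0" shows "degree p \<noteq> 0"
  using assms by (metis degree_eq_zeroE mult_zero_right pCons_0_0 poly_pCons poly_0 add.right_neutral)

text \<open>A vanishing resultant means a nonconstant gcd, and over the complex numbers a nonzero
  polynomial is nonconstant iff it has a root.\<close>

lemma resultant_eq_0_iff_common_root: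
  fixes p q :: "complex poly"
  assumes "p \<noteq> 0 \<or> q \<noteq> 0"
  shows "resultant p q = 0 \<longleftrightarrow> (\<exists>y. poly p y = 0 \<and> poly q y = 0)"
proof -
  have "degree (gcd p q) \<noteq> 0 \<longleftrightarrow> (\<exists>y. poly (gcd p q) y = 0)"
  proof
    assume "degree (gcd p q) \<noteq> 0"
    then have "degree (gcd p q) > 0" by simp
    then show "\<exists>y. poly (gcd p q) y = 0"
      by (rule alg_closed_imp_poly_has_root)
  next
    assume "\<exists>y. poly (gcd p q) y = 0"
    then obtain y where y: "poly (gcd p q) y = 0" ..
    have "gcd p q \<noteq> 0" using assms by simp
    then show "degree (gcd p q) \<noteq> 0" using y degree_nonzero_of_root by blast
  qed
  also have "(\<exists>y. poly (gcd p q) y = 0) \<longleftrightarrow> (\<exists>y. poly p y = 0 \<and> poly q y = 0)"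
    by (simp add: poly_eq_0_iff_dvd)
  finally show ?thesis by (simp add: resultant_0_gcd)
qed

lemma degree_map_poly_eval:
  "poly (lead_coeff P) x \<noteq> 0 \<Longrightarrow> degree (map_poly (\<lambda>c. poly c x) P) = degree P"
  by (intro antisym degree_map_poly_le le_degree) (simp add: coeff_map_poly)

lemma unit_bipoly_nonzero:
  assumes "is_unit P" shows "bipoly P x y \<noteq> 0"
proof -
  obtain Q where "1 = P * Q" using assms by (rule dvdE)
  then have "bipoly P x y * bipoly Q x y = 1" by (metis bipoly_simps(2,7))
  then show ?thesis by auto
qed

text \<open>The resultant with respect to \<open>y\<close> is a nonzero polynomial in
  \<open>x\<close>, which leaves finitely many \<open>x\<close>. Over each of them one of the two
  specialisations is nonzero and leaves finitely many \<open>y\<close>.\<close>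

lemma coprime_bipoly_finite_zeros:
  assumes "coprime P Q"
  shows "finite {(x, y). bipoly P x y = 0 \<and> bipoly Q x y = 0}"
proof (cases "P = 0 \<or> Q = 0")
  case True
  then have "is_unit P \<or> is_unit Q" using assms by auto
  then show ?thesis using unit_bipoly_nonzero by (auto intro: finite_subset[of _ "{}"])
next
  case False
  have "gcd P Q = 1" using assms by (simp add: coprime_iff_gcd_eq_1)
  then have R: "resultant P Q \<noteq> 0" using resultant_0_gcd[of P Q] by simp
  \<comment> \<open>Where a leading coefficient vanishes the degree drops and the resultant need not
    specialise, so these \<open>x\<close> are included.\<close>
  define Z where "Z = {x. poly (resultant P Q) x = 0} \<union> {x. poly (lead_coeff P) x = 0} \<union> {x. poly (lead_coeff Q) x = 0}"
  have not_both: "map_poly (\<lambda>c. poly c x) P \<noteq> 0 \<or> map_poly (\<lambda>c. poly c x) Q \<noteq> 0" for x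
  proof (rule ccontr)
    \<comment> \<open>\<open>[:[:-x, 1:]:]\<close> is the equation of a vertical line; as a common
      factor of \<open>P\<close> and \<open>Q\<close> it would contradict coprimality.\<close>
    have dvd: "[:[:-x, 1:]:] dvd T" if "map_poly (\<lambda>c. poly c x) T = 0" for T
    proof -
      have "poly (coeff T n) x = 0" for n
        using arg_cong[OF that, of "\<lambda>p. coeff p n"] by (simp add: coeff_map_poly)
      then show ?thesis by (simp add: const_poly_dvd_iff poly_eq_0_iff_dvd)
    qed
    assume "\<not> ?thesis"
    then have "[:[:-x, 1:]:] dvd 1"
      using dvd assms by (meson coprime_common_divisor)
    then show False by (simp add: is_unit_const_poly_iff is_unit_pCons_iff)
  qed
  have "finite Z"
    unfolding Z_def using R False by (auto intro!: poly_roots_finite)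
  moreover have "x \<in> Z" if "bipoly P x y = 0" "bipoly Q x y = 0" for x y
  proof (rule ccontr)
    assume x: "x \<notin> Z"
    let ?P = "map_poly (\<lambda>c. poly c x) P" and ?Q = "map_poly (\<lambda>c. poly c x) Q"
    have "resultant ?P ?Q = poly (resultant P Q) x"
      using x by (intro poly_hom.resultant_map_poly degree_map_poly_eval) (auto simp: Z_def)
    then have "resultant ?P ?Q \<noteq> 0" using x by (simp add: Z_def)
    then show False
      using that resultant_eq_0_iff_common_root[OF not_both[of x]] by (auto simp: poly_map_poly_eval)
  qed
  then have "{(x, y). bipoly P x y = 0 \<and> bipoly Q x y = 0} \<subseteq>
    (SIGMA x:Z. {y. bipoly P x y = 0 \<and> bipoly Q x y = 0})"
    by auto
  moreover have "finite {y. bipoly P x y = 0 \<and> bipoly Q x y = 0}" for x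
    using not_both[of x]
  proof
    assume "map_poly (\<lambda>c. poly c x) P \<noteq> 0"
    then have "finite {y. bipoly P x y = 0}"
      unfolding poly_map_poly_eval[symmetric] by (rule poly_roots_finite)
    then show ?thesis by (rule rev_finite_subset) auto
  next
    assume "map_poly (\<lambda>c. poly c x) Q \<noteq> 0"
    then have "finite {y. bipoly Q x y = 0}"
      unfolding poly_map_poly_eval[symmetric] by (rule poly_roots_finite)
    then show ?thesis by (rule rev_finite_subset) auto
  qed
  ultimately show ?thesis by (auto intro: finite_subset)
qed

text \<open>\<open>H\<close> is built as an iterated gcd. At each step the zeros off the gcd are
  common zeros of coprime cofactors, or old exceptional points, hence finite in number.\<close>

lemma common_zeros_bipoly:
  assumes "finite A"
  obtains H F where "finite F" "\<And>P. P \<in> A \<Longrightarrow> H dvd P"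
    "\<And>x y. (\<forall>P\<in>A. bipoly P x y = 0) \<longleftrightarrow> bipoly H x y = 0 \<or> (x, y) \<in> F"
proof -
  have "\<exists>H F. finite F \<and> (\<forall>P\<in>A. H dvd P) \<and>
    (\<forall>x y. (\<forall>P\<in>A. bipoly P x y = 0) \<longleftrightarrow> bipoly H x y = 0 \<or> (x, y) \<in> F)"
    using assms
  proof (induction A)
    case empty
    \<comment> \<open>The empty family vanishes everywhere, so its gcd is \<open>0\<close>.\<close>
    show ?case by (intro exI[of _ 0] exI[of _ "{}"]) simp
  next
    case (insert P A)
    then obtain H F where HF: "finite F" "\<forall>P\<in>A. H dvd P"
      "\<forall>x y. (\<forall>P\<in>A. bipoly P x y = 0) \<longleftrightarrow> bipoly H x y = 0 \<or> (x, y) \<in> F" by (elim exE conjE)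
    obtain H' P' where HP: "H = gcd H P * H'" "P = gcd H P * P'" "coprime H' P' \<or> gcd H P = 0"
    proof (cases "gcd H P = 0")
      case True
      then show ?thesis using that[of 0 0] by simp
    next
      case False
      then show ?thesis
        using gcd_coprime_exists[of H P] that by (metis mult.commute)
    qed
    define G where "G = gcd H P"
    define F' where "F' = {(x, y) \<in> F. bipoly P x y = 0} \<union> 
      (if G = 0 then {} else {(x, y). bipoly H' x y = 0 \<and> bipoly P' x y = 0})"
    have ev: "bipoly H x y = bipoly G x y * bipoly H' x y" "bipoly P x y = bipoly G x y * bipoly P' x y" for x y
      unfolding G_def by (subst HP(1), simp, subst HP(2), simp)
    have "finite {(x, y). bipoly H' x y = 0 \<and> bipoly P' x y = 0}" if "G \<noteq> 0"
      using that HP(3) by (intro coprime_bipoly_finite_zeros) (auto simp: G_def)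
    moreover have "finite {(x, y) \<in> F. bipoly P x y = 0}"
      using HF(1) by (rule rev_finite_subset) auto
    ultimately have "finite F'" unfolding F'_def by auto
    have "\<forall>Q\<in>insert P A. G dvd Q"
      unfolding G_def using HF(2) by (auto intro: dvd_trans)
    moreover have "(\<forall>Q\<in>insert P A. bipoly Q x y = 0) \<longleftrightarrow> bipoly G x y = 0 \<or> (x, y) \<in> F'" for x y
    proof -
      have "(\<forall>Q\<in>insert P A. bipoly Q x y = 0) \<longleftrightarrow>
        bipoly P x y = 0 \<and> (bipoly H x y = 0 \<or> (x, y) \<in> F)"
        using HF(3) by auto
      also have "\<dots> \<longleftrightarrow> bipoly G x y = 0 \<or> (x, y) \<in> F'"
        unfolding F'_def using ev[of x y] by (cases "G = 0") auto
      finally show ?thesis .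
    qed
    ultimately show ?case using \<open>finite F'\<close> by blast
  qed
  then obtain H F where HF: "finite F" "\<forall>P\<in>A. H dvd P"
    "\<forall>x y. (\<forall>P\<in>A. bipoly P x y = 0) \<longleftrightarrow> bipoly H x y = 0 \<or> (x, y) \<in> F" by (elim exE conjE)
  show ?thesis
    by (rule that[OF HF(1) HF(2)[rule_format] HF(3)[rule_format]])
qed

text \<open>Let \<open>n\<close> be the total degree. After substituting \<open>x + t * y\<close>
  for \<open>x\<close>, the coefficient of \<open>y ^ n\<close> is the top homogeneous form
  evaluated at \<open>(t, 1)\<close>: a constant in \<open>x\<close>, and nonzero for all but
  finitely many \<open>t\<close>.\<close>

lemma shear_lead_coeff_constant:
  assumes "\<And>c. P \<noteq> [:[:c:]:]"
  obtains S :: "complex set" where "finite S" "\<And>t. t \<notin> S \<Longrightarrow>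
    \<exists>Q. degree Q > 0 \<and> degree (lead_coeff Q) = 0 \<and> (\<forall>x y. bipoly Q x y = bipoly P (x + t * y) y)"
proof -
  define c where "c = (\<lambda>i j. coeff (coeff P j) i)"
  define B where "B = {(i, j). c i j \<noteq> 0}"
  \<comment> \<open>The index range of \<open>bipoly_altdef\<close>; its pairs are ordered
    \<open>(j, i)\<close>, hence the swap below.\<close>
  define B0 where "B0 = (SIGMA j:{..degree P}. {..degree (coeff P j)})"
  have BB0: "B \<subseteq> prod.swap ` B0"
    unfolding B_def B0_def c_def by (force intro!: le_degree)
  have fin0: "finite B0" by (simp add: B0_def)
  have fin: "finite B" using BB0 fin0 finite_subset by blast
  have ev: "bipoly P x y = (\<Sum>(i, j)\<in>B. c i j * x ^ i * y ^ j)" for x y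
  proof -
    have "bipoly P x y = (\<Sum>(j, i)\<in>B0. c i j * x ^ i * y ^ j)"
      unfolding bipoly_altdef B0_def c_def by (simp add: sum.Sigma)
    also have "\<dots> = (\<Sum>(i, j)\<in>prod.swap ` B0. c i j * x ^ i * y ^ j)"
      by (subst sum.reindex) (auto simp: case_prod_beta)
    also have "\<dots> = (\<Sum>(i, j)\<in>B. c i j * x ^ i * y ^ j)"
      using BB0 fin0 by (intro sum.mono_neutral_right) (auto simp: B_def)
    finally show ?thesis .
  qed
  have "\<exists>(i, j)\<in>B. i + j > 0"
  proof (rule ccontr)
    assume "\<not> ?thesis"
    then have "c i j = 0" if "i + j > 0" for i j using that unfolding B_def by auto
    then have "P = [:[:c 0 0:]:]"
      unfolding c_def by (intro poly_eqI) (auto simp: coeff_pCons split: nat.splits)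
    then show False using assms by blast
  qed
  then have neB: "B \<noteq> {}" by auto
  define n where "n = Max ((\<lambda>(i, j). i + j) ` B)"
  have n_ge: "i + j \<le> n" if "(i, j) \<in> B" for i j
    unfolding n_def using that fin by (auto intro!: Max_ge)
  have n0: "n > 0" using \<open>\<exists>(i, j)\<in>B. i + j > 0\<close> n_ge by force
  have "n \<in> (\<lambda>(i, j). i + j) ` B"
    unfolding n_def using fin neB by (intro Max_in) auto
  then obtain i0 j0 where ij0: "(i0, j0) \<in> B" "i0 + j0 = n" by auto
  define Bn where "Bn = {(i, j) \<in> B. i + j = n}"
  have finBn: "finite Bn" unfolding Bn_def using fin by (auto intro: finite_subset)
  \<comment> \<open>The top form at \<open>(t, 1)\<close> as a polynomial in \<open>t\<close>. Pairs
    in \<open>Bn\<close> with equal \<open>i\<close> coincide, so nothing cancels.\<close>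
  define A where "A = (\<Sum>(i, j)\<in>Bn. monom (c i j) i)"
  have "coeff A i0 = (\<Sum>(i, j)\<in>Bn. if (i, j) = (i0, j0) then c i j else 0)"
    unfolding A_def coeff_sum by (intro sum.cong) (use ij0 in \<open>auto simp: Bn_def\<close>)
  also have "\<dots> = (\<Sum>z\<in>Bn. if z = (i0, j0) then c i0 j0 else 0)"
    by (intro sum.cong) (auto split: if_splits)
  also have "\<dots> = c i0 j0" using finBn ij0 by (simp add: Bn_def)
  finally have A0: "A \<noteq> 0" using ij0 by (auto simp: B_def)
  show ?thesis
  proof (rule that[of "{t. poly A t = 0}"])
    show "finite {t. poly A t = 0}" using A0 by (rule poly_roots_finite)
    fix t assume t: "t \<notin> {t. poly A t = 0}"
    \<comment> \<open>\<open>L\<close> is the form \<open>x + t * y\<close> and \<open>M i j\<close>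
      is the sheared monomial. Since \<open>t\<close> may be \<open>0\<close>, only upper bounds for
      their degrees are claimed.\<close>
    define L where "L = [:[:0, 1:], [:t:]:]"
    define M where "M = (\<lambda>i j. L ^ i * [:0, 1:] ^ j)"
    have L: "degree (L ^ i) \<le> i \<and> coeff (L ^ i) i = [:t ^ i:]" for i
    proof (induction i)
      case (Suc i)
      have "degree L \<le> 1" by (simp add: L_def)
      then have "degree (L ^ Suc i) \<le> Suc i"
        using degree_power_le[of L "Suc i"] mult_le_mono1[of "degree L" 1 "Suc i"] by (simp only: mult_1 le_trans)
      have "coeff (L ^ i) (Suc i) = 0"
        using Suc by (intro coeff_eq_0) auto
      moreover have "L ^ Suc i = Polynomial.smult [:0, 1:] (L ^ i) + pCons 0 (Polynomial.smult [:t:] (L ^ i))"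
        by (simp add: L_def)
      ultimately have "coeff (L ^ Suc i) (Suc i) = [:t ^ Suc i:]"
        using Suc by simp
      then show ?case using \<open>degree (L ^ Suc i) \<le> Suc i\<close> by blast
    qed simp
    have X: "[:0, 1:] ^ j = (monom 1 j :: complex poly poly)" for j
      by (simp only: monom_altdef smult_1_left)
    have M: "degree (M i j) \<le> i + j" for i j
      unfolding M_def X using L[of i] degree_mult_le[of "L ^ i" "monom 1 j"]
      by (simp add: degree_monom_eq)
    have cM: "coeff (M i j) (i + j) = [:t ^ i:]" for i j
    proof -
      have "M i j = monom 1 j * L ^ i" unfolding M_def X by (rule mult.commute)
      then show ?thesis using L[of i] by (simp add: coeff_monom_mult)
    qed
    define Q where "Q = (\<Sum>(i, j)\<in>B. Polynomial.smult [:c i j:] (M i j))"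
    have "bipoly Q x y = bipoly P (x + t * y) y" for x y
      unfolding Q_def ev bipoly_sum
      by (intro sum.cong) (auto simp: M_def L_def mult_ac)
    moreover have dQ: "degree Q \<le> n"
      unfolding Q_def
    proof (intro degree_sum_le fin, clarify)
      fix i j assume "(i, j) \<in> B"
      then show "degree (Polynomial.smult [:c i j:] (M i j)) \<le> n"
        using M[of i j] n_ge[of i j] degree_smult_le[of "[:c i j:]" "M i j"] by linarith
    qed
    moreover have cQ: "coeff Q n = [:poly A t:]"
    proof -
      have "coeff Q n = (\<Sum>(i, j)\<in>B. if i + j = n then [:c i j * t ^ i:] else 0)"
        unfolding Q_def coeff_sum
      proof (intro sum.cong refl, clarify)
        fix i j assume "(i, j) \<in> B"
        then show "coeff (Polynomial.smult [:c i j:] (M i j)) n = (if i + j = n then [:c i j * t ^ i:] else 0)"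
          using M[of i j] cM[of i j] n_ge[of i j] by (auto simp: coeff_eq_0)
      qed
      also have "\<dots> = (\<Sum>(i, j)\<in>Bn. [:c i j * t ^ i:])"
        unfolding Bn_def using fin by (intro sum.mono_neutral_cong_right) auto
      also have "\<dots> = [:\<Sum>(i, j)\<in>Bn. c i j * t ^ i:]"
        by (induction Bn rule: infinite_finite_induct) auto
      also have "(\<Sum>(i, j)\<in>Bn. c i j * t ^ i) = poly A t"
        unfolding A_def poly_sum by (intro sum.cong) (auto simp: poly_monom)
      finally show ?thesis .
    qed
    moreover have "degree Q = n"
      using dQ cQ t by (intro antisym le_degree) auto
    ultimately show "\<exists>Q. degree Q > 0 \<and> degree (lead_coeff Q) = 0 \<and>
        (\<forall>x y. bipoly Q x y = bipoly P (x + t * y) y)"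
      using n0 by (intro exI[of _ Q]) auto
  qed
qed

text \<open>The variable \<open>x\<close> is outermost, so each \<open>coeff T k\<close> is a
  polynomial in the target coordinates \<open>u\<close> (inner) and \<open>v\<close>
  (outer).\<close>

definition tripoly :: "complex poly poly poly \<Rightarrow> complex \<Rightarrow> complex \<Rightarrow> complex \<Rightarrow> complex" where
  "tripoly T x u v = bipoly (poly T [:[:x:]:]) u v"

text \<open>A predicate on functions, so that a determinant can be shown polynomial by closure
  properties, without constructing \<open>T\<close> explicitly.\<close>

definition poly3 :: "(complex \<Rightarrow> complex \<Rightarrow> complex \<Rightarrow> complex) \<Rightarrow> bool" where
  "poly3 F \<longleftrightarrow> (\<exists>T. \<forall>x u v. F x u v = tripoly T x u v)"

lemma poly3_const [intro]: "poly3 (\<lambda>_ _ _. c)"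
  unfolding poly3_def tripoly_def by (intro exI[of _ "[:[:[:c:]:]:]"]) simp

lemma poly3_vars [intro]:
  "poly3 (\<lambda>x _ _. x)" "poly3 (\<lambda>_ u _. u)" "poly3 (\<lambda>_ _ v. v)"
  unfolding poly3_def tripoly_def
  by (intro exI[of _ "[:0, 1:]"], simp, intro exI[of _ "[:[:[:0, 1:]:]:]"], simp,
      intro exI[of _ "[:[:0, 1:]:]"], simp)

lemma poly3_add [intro]:
  assumes "poly3 F" "poly3 G" shows "poly3 (\<lambda>x u v. F x u v + G x u v)"
proof -
  obtain S T where "\<forall>x u v. F x u v = tripoly S x u v" "\<forall>x u v. G x u v = tripoly T x u v"
    using assms unfolding poly3_def by blast
  then show ?thesis
    unfolding poly3_def tripoly_def by (intro exI[of _ "S + T"]) simp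
qed

lemma poly3_mult [intro]:
  assumes "poly3 F" "poly3 G" shows "poly3 (\<lambda>x u v. F x u v * G x u v)"
proof -
  obtain S T where "\<forall>x u v. F x u v = tripoly S x u v" "\<forall>x u v. G x u v = tripoly T x u v"
    using assms unfolding poly3_def by blast
  then show ?thesis
    unfolding poly3_def tripoly_def by (intro exI[of _ "S * T"]) simp
qed

lemma poly3_diff [intro]:
  assumes "poly3 F" "poly3 G" shows "poly3 (\<lambda>x u v. F x u v - G x u v)"
  using poly3_add[OF assms(1) poly3_mult[OF poly3_const[of "-1"] assms(2)]] by simp

lemma poly3_sum [intro]:
  "(\<And>i. i \<in> A \<Longrightarrow> poly3 (F i)) \<Longrightarrow> poly3 (\<lambda>x u v. \<Sum>i\<in>A. F i x u v)"
  by (induction A rule: infinite_finite_induct) auto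

lemma poly3_prod [intro]:
  "(\<And>i. i \<in> A \<Longrightarrow> poly3 (F i)) \<Longrightarrow> poly3 (\<lambda>x u v. \<Prod>i\<in>A. F i x u v)"
  by (induction A rule: infinite_finite_induct) auto

lemma poly3_poly [intro]: "poly3 (\<lambda>x _ _. poly a x)"
  by (induction a) (auto intro!: poly3_add poly3_const poly3_mult poly3_vars)

lemma poly3_det:
  assumes "\<And>x u v. A x u v \<in> carrier_mat n n"
    and "\<And>i j. i < n \<Longrightarrow> j < n \<Longrightarrow> poly3 (\<lambda>x u v. A x u v $$ (i, j))"
  shows "poly3 (\<lambda>x u v. det (A x u v))"
proof -
  have "poly3 (\<lambda>x u v. \<Sum>p\<in>{p. p permutes {0..<n}}. signof p * (\<Prod>i=0..<n. A x u v $$ (i, p i)))"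
    using permutes_in_image by (intro poly3_sum poly3_mult poly3_prod poly3_const assms) fastforce+
  then show ?thesis using det_def'[OF assms(1)] by simp
qed

text \<open>\<open>T\<close> is the resultant of \<open>P - u\<close> and \<open>Q - v\<close> with
  respect to \<open>y\<close>. As the leading coefficients are constants and the degrees positive,
  the Sylvester matrix has the same size and shape for all \<open>x\<close>, \<open>u\<close>,
  \<open>v\<close>; so its determinant is polynomial and detects common roots without
  exception.\<close>

lemma elimination:
  assumes "degree P > 0" "degree Q > 0" "degree (lead_coeff P) = 0" "degree (lead_coeff Q) = 0"
  obtains T where "\<And>x u v. tripoly T x u v = 0 \<longleftrightarrow> (\<exists>y. bipoly P x y = u \<and> bipoly Q x y = v)"
proof -
  define E where "E = (\<lambda>P x u. map_poly (\<lambda>c. poly c x) P - [:u::complex:])"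
  define m n where "m = degree P" "n = degree Q"
  have deg: "degree (E P x u) = degree P" if pos: "degree P > 0" and lead: "degree (lead_coeff P) = 0" for P x u
  proof -
    obtain a where a: "lead_coeff P = [:a:]" using lead degree_eq_zeroE by blast
    then have "a \<noteq> 0" using pos by auto
    then have "degree (map_poly (\<lambda>c. poly c x) P) = degree P"
      by (intro degree_map_poly_eval) (simp add: a)
    then show ?thesis
      unfolding E_def diff_conv_add_uminus using pos by (subst degree_add_eq_left) auto
  qed
  have c3: "poly3 (\<lambda>x u v. coeff (E P x (g u v)) k)" if "poly3 (\<lambda>x u v. g u v)" for P k g
    unfolding E_def coeff_diff using that
    by (cases k) (auto simp: coeff_map_poly intro!: poly3_diff)
  have "poly3 (\<lambda>x u v. det (sylvester_mat (E P x u) (E Q x v)))"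
  proof (rule poly3_det[where n = "m + n"])
    show "sylvester_mat (E P x u) (E Q x v) \<in> carrier_mat (m + n) (m + n)" for x u v
      using sylvester_carrier_mat[of "E P x u" "E Q x v"] deg assms by (simp add: m_n_def)
    fix i j assume ij: "i < m + n" "j < m + n"
    have "sylvester_mat (E P x u) (E Q x v) $$ (i, j) =
     (if i < n then if i \<le> j \<and> j - i \<le> m then coeff (E P x u) (m + i - j) else 0
      else if i - n \<le> j \<and> j \<le> i then coeff (E Q x v) (i - j) else 0)" for x u v
      using sylvester_index_mat[of i "E P x u" "E Q x v" j] deg assms ij by (simp add: m_n_def)
    then show "poly3 (\<lambda>x u v. sylvester_mat (E P x u) (E Q x v) $$ (i, j))"
      using c3[of "\<lambda>u v. u", OF poly3_vars(2)] c3[of "\<lambda>u v. v", OF poly3_vars(3)] poly3_const[of 0]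
      by (cases "i < n"; cases "i \<le> j \<and> j - i \<le> m"; cases "i - n \<le> j \<and> j \<le> i") simp_all
  qed
  then obtain T where T: "\<And>x u v. resultant (E P x u) (E Q x v) = tripoly T x u v"
    unfolding poly3_def resultant_def by blast
  have "E P x u \<noteq> 0" for x u using deg[of P x u] assms by auto
  show ?thesis
  proof (rule that)
    fix x u v
    have "tripoly T x u v = 0 \<longleftrightarrow> (\<exists>y. poly (E P x u) y = 0 \<and> poly (E Q x v) y = 0)"
      unfolding T[symmetric] using \<open>E P x u \<noteq> 0\<close> by (intro resultant_eq_0_iff_common_root) simp
    then show "tripoly T x u v = 0 \<longleftrightarrow> (\<exists>y. bipoly P x y = u \<and> bipoly Q x y = v)"
      by (simp add: E_def poly_map_poly_eval)
  qed
qed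

lemma tripoly_altdef:
  "tripoly T x u v = (\<Sum>k\<le>degree T. bipoly (coeff T k) u v * x ^ k)"
  unfolding tripoly_def poly_altdef[of T] by (simp add: bipoly_sum)

lemma poly_nonvanishing_const:
  fixes p :: "complex poly"
  assumes "\<And>x. poly p x \<noteq> 0" shows "degree p = 0"
  using assms alg_closed_imp_poly_has_root by blast

text \<open>Along each horizontal or vertical line a polynomial without zeros is constant, and two
  such lines join any point to the origin.\<close>

lemma poly2_nonvanishing_const:
  assumes "poly2 p" "\<And>z. p z \<noteq> 0" shows "p z = p (0, 0)"
proof -
  obtain P where P: "\<And>x y. p (x, y) = bipoly P x y"
    using assms poly2_iff_bipoly by metis
  have const: "poly q a = poly q b" if "\<And>x. poly q x \<noteq> 0" for q :: "complex poly" and a b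
    using poly_nonvanishing_const[OF that] by (metis degree_eq_zeroE poly_pCons mult_zero_right poly_0)
  obtain x y where z: "z = (x, y)" by (cases z)
  have "bipoly P x y = bipoly P 0 y"
    unfolding bipoly_def using assms(2) P by (intro const) (metis bipoly_def)
  also have "\<dots> = bipoly P 0 0"
    unfolding poly_map_poly_eval[symmetric] using assms(2) P by (intro const) (metis poly_map_poly_eval)
  finally show ?thesis using P z by simp
qed

section \<open>The image is cofinite\<close>

context keller_map
begin

lemma components_nonconstant:
  assumes "(\<forall>x y. bipoly P x y = fst (f (x, y))) \<or> (\<forall>x y. bipoly P x y = snd (f (x, y)))"
  shows "P \<noteq> [:[:c:]:]"
proof
  assume "P = [:[:c:]:]"
  then have "(\<forall>x y. fst (f (x, y)) = c) \<or> (\<forall>x y. snd (f (x, y)) = c)"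
    using assms by auto
  then have "jacobian_det2 f x y = 0" for x y
    unfolding jacobian_det2_def by auto
  then show False using jacobian unfolding const_nonzero_jacobian2_def by metis
qed

text \<open>The roots of \<open>T\<close> in \<open>x\<close> are the values
  \<open>a - t * b\<close> for points \<open>(a, b)\<close> over \<open>(u, v)\<close>. Almost all
  \<open>t\<close> are provided because two of them are needed to recover both coordinates.\<close>

lemma eliminant:
  obtains S :: "complex set" where "finite S"
    "\<And>t. t \<notin> S \<Longrightarrow> \<exists>T. \<forall>x u v. tripoly T x u v = 0 \<longleftrightarrow> (\<exists>y. f (x + t * y, y) = (u, v))"
proof -
  obtain P where P: "\<And>x y. fst (f (x, y)) = bipoly P x y"
    using poly_map poly2_iff_bipoly unfolding poly_map2_def by metis
  obtain Q where Q: "\<And>x y. snd (f (x, y)) = bipoly Q x y"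
    using poly_map poly2_iff_bipoly unfolding poly_map2_def by metis
  have "P \<noteq> [:[:c:]:]" "Q \<noteq> [:[:c:]:]" for c
    using P Q by (auto intro!: components_nonconstant)
  then obtain S1 S2 :: "complex set" where S: "finite S1" "finite S2" 
    "\<And>t. t \<notin> S1 \<Longrightarrow> \<exists>P'. degree P' > 0 \<and> degree (lead_coeff P') = 0 \<and> (\<forall>x y. bipoly P' x y = bipoly P (x + t * y) y)"
    "\<And>t. t \<notin> S2 \<Longrightarrow> \<exists>Q'. degree Q' > 0 \<and> degree (lead_coeff Q') = 0 \<and> (\<forall>x y. bipoly Q' x y = bipoly Q (x + t * y) y)"
    using shear_lead_coeff_constant[of P] shear_lead_coeff_constant[of Q] by metis
  show ?thesis
  proof (rule that[of "S1 \<union> S2"])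
    show "finite (S1 \<union> S2)" using S by simp
    fix t assume "t \<notin> S1 \<union> S2"
    then obtain P' Q' where P': "degree P' > 0" "degree (lead_coeff P') = 0"
        "\<And>x y. bipoly P' x y = bipoly P (x + t * y) y"
      and Q': "degree Q' > 0" "degree (lead_coeff Q') = 0"
        "\<And>x y. bipoly Q' x y = bipoly Q (x + t * y) y"
      using S(3,4)[of t] by auto
    obtain T where "\<And>x u v. tripoly T x u v = 0 \<longleftrightarrow> (\<exists>y. bipoly P' x y = u \<and> bipoly Q' x y = v)"
      using elimination[OF P'(1) Q'(1) P'(2) Q'(2)] by blast
    then have "\<forall>x u v. tripoly T x u v = 0 \<longleftrightarrow> (\<exists>y. f (x + t * y, y) = (u, v))"
      by (simp add: P'(3) Q'(3) P[symmetric] Q[symmetric] prod_eq_iff)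
    then show "\<exists>T. \<forall>x u v. tripoly T x u v = 0 \<longleftrightarrow> (\<exists>y. f (x + t * y, y) = (u, v))" ..
  qed
qed

text \<open>For fixed \<open>(u, v)\<close> the eliminant is a nonzero polynomial in
  \<open>x\<close>. It has a root iff it is nonconstant, that is, iff some coefficient of positive
  degree is nonzero.\<close>

lemma range_iff_eliminant_coeff:
  assumes T: "\<And>x u v. tripoly T x u v = 0 \<longleftrightarrow> (\<exists>y. f (x + t * y, y) = (u, v))"
  shows "(u, v) \<in> range f \<longleftrightarrow> (\<exists>k\<in>{1..degree T}. bipoly (coeff T k) u v \<noteq> 0)"
proof -
  have range: "(u, v) \<in> range f \<longleftrightarrow> (\<exists>x. tripoly T x u v = 0)"
  proof
    assume "(u, v) \<in> range f"
    then obtain a b where "f (a, b) = (u, v)" by auto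
    then have "f ((a - t * b) + t * b, b) = (u, v)" by simp
    then show "\<exists>x. tripoly T x u v = 0" using T by blast
  qed (use T in \<open>metis rangeI\<close>)
  define q where "q = (\<Sum>k\<le>degree T. monom (bipoly (coeff T k) u v) k)"
  have q: "poly q x = tripoly T x u v" for x
    by (simp add: q_def tripoly_altdef poly_sum poly_monom)
  have coeff_q: "coeff q k = (if k \<le> degree T then bipoly (coeff T k) u v else 0)" for k
    by (simp add: q_def coeff_sum coeff_monom)
  \<comment> \<open>This excludes the zero polynomial, which has roots but no nonzero
    coefficient.\<close>
  obtain x0 where x0: "tripoly T x0 u v \<noteq> 0"
    using some_line_avoids_fibre[of t "(u, v)"] T by auto
  have "(\<exists>x. tripoly T x u v = 0) \<longleftrightarrow> degree q \<noteq> 0"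
  proof
    assume "\<exists>x. tripoly T x u v = 0"
    then show "degree q \<noteq> 0"
      using x0 q by (metis degree_nonzero_of_root poly_0)
  next
    assume "degree q \<noteq> 0"
    then show "\<exists>x. tripoly T x u v = 0"
      using poly_nonvanishing_const[of q] q by metis
  qed
  also have "\<dots> \<longleftrightarrow> (\<exists>k\<in>{1..degree T}. coeff q k \<noteq> 0)"
  proof
    assume "degree q \<noteq> 0"
    moreover from this have "coeff q (degree q) \<noteq> 0" by auto
    moreover from this have "degree q \<le> degree T" using coeff_q by metis
    ultimately show "\<exists>k\<in>{1..degree T}. coeff q k \<noteq> 0" by (intro bexI[of _ "degree q"]) auto
  next
    assume "\<exists>k\<in>{1..degree T}. coeff q k \<noteq> 0"
    then show "degree q \<noteq> 0" using le_degree by fastforce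
  qed
  finally show ?thesis using range coeff_q by auto
qed

lemma finite_compl_range: "finite (- range f)"
proof -
  obtain S where S: "finite S" 
    "\<And>t. t \<notin> S \<Longrightarrow> \<exists>T. \<forall>x u v. tripoly T x u v = 0 \<longleftrightarrow> (\<exists>y. f (x + t * y, y) = (u, v))"
    by (rule eliminant) auto
  obtain t where "t \<notin> S" using S(1) ex_new_if_finite infinite_UNIV_char_0 by blast
  then obtain T where T: "\<And>x u v. tripoly T x u v = 0 \<longleftrightarrow> (\<exists>y. f (x + t * y, y) = (u, v))"
    using S(2) by blast
  define A where "A = coeff T ` {1..degree T}"
  have "finite A" by (simp add: A_def)
  then obtain H F where HF: "finite F" "\<And>P. P \<in> A \<Longrightarrow> H dvd P"
    "\<And>u v. (\<forall>P\<in>A. bipoly P u v = 0) \<longleftrightarrow> bipoly H u v = 0 \<or> (u, v) \<in> F"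
    by (rule common_zeros_bipoly) auto
  have compl: "(u, v) \<notin> range f \<longleftrightarrow> bipoly H u v = 0 \<or> (u, v) \<in> F" for u v
    unfolding HF(3)[symmetric] range_iff_eliminant_coeff[OF T] A_def by auto
  have pH: "poly2 (\<lambda>z. bipoly H (fst (f z)) (snd (f z)))"
    using poly2_compose[OF poly2_bipoly, of "\<lambda>z. fst (f z)" "\<lambda>z. snd (f z)" H] poly_map
    unfolding poly_map2_def by simp
  \<comment> \<open>Every zero of \<open>H\<close> is an omitted value, so \<open>H\<close> has no
    zero on the image.\<close>
  have nz: "bipoly H (fst (f z)) (snd (f z)) \<noteq> 0" for z
    using compl[of "fst (f z)" "snd (f z)"] by auto
  define c where "c = bipoly H (fst (f (0, 0))) (snd (f (0, 0)))"
  have "bipoly H (fst w) (snd w) = c" if "w \<in> range f" for w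
    using that poly2_nonvanishing_const[OF pH nz] unfolding c_def by auto
  \<comment> \<open>The image is open and nonempty, so constancy there extends to the plane.\<close>
  then have "bipoly H (fst w) (snd w) = c" for w
    using poly2_eq_open[OF poly2_bipoly poly2_const open_map[OF open_UNIV]] by blast
  then have "bipoly H u v \<noteq> 0" for u v
    using nz unfolding c_def by (metis fst_conv snd_conv)
  then have "- range f \<subseteq> F" using compl by auto
  then show ?thesis using HF(1) finite_subset by blast
qed

end

section \<open>Injective maps have polynomial inverses\<close>

lemma poly_lower_bound:
  fixes r :: "complex poly"
  assumes "r \<noteq> 0"
  obtains \<delta> R where "\<delta> > 0" "\<And>s. norm s \<ge> R \<Longrightarrow> norm (poly r s) \<ge> \<delta>"
proof (cases "degree r = 0")
  case True
  then obtain a where "r = [:a:]" by (rule degree_eq_zeroE)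
  then show ?thesis using assms that[of "norm a" 0] by simp
next
  case False
  then have "filterlim (poly r) at_infinity at_infinity"
    by (intro filterlim_poly_at_infinity filterlim_ident) auto
  then have "eventually (\<lambda>s. 1 \<le> norm (poly r s)) at_infinity"
    unfolding filterlim_at_infinity[of 0, simplified] by auto
  then show ?thesis using that[of 1] unfolding eventually_at_infinity by auto
qed

lemma poly_upper_bound:
  fixes r :: "complex poly"
  assumes "degree r \<le> D" "norm s \<ge> 1"
  shows "norm (poly r s) \<le> (\<Sum>i\<le>degree r. norm (coeff r i)) * norm s ^ D"
proof -
  have "norm (poly r s) \<le> (\<Sum>i\<le>degree r. norm (coeff r i) * norm s ^ i)"
    unfolding poly_altdef by (rule order_trans[OF norm_sum]) (simp add: norm_mult norm_power)
  also have "\<dots> \<le> (\<Sum>i\<le>degree r. norm (coeff r i) * norm s ^ D)"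
    using assms by (intro sum_mono mult_left_mono power_increasing) auto
  finally show ?thesis by (simp add: sum_distrib_right)
qed

text \<open>Where \<open>F\<close> exceeds \<open>1\<close> in norm, the relation divided by
  \<open>F s ^ (d - 1)\<close> bounds \<open>F s\<close> by a multiple of \<open>norm s ^ D\<close>,
  since the leading coefficient stays away from \<open>0\<close> for large \<open>s\<close>.
  Polynomial growth and Liouville's theorem finish the argument.\<close>

lemma entire_algebraic_imp_poly:
  fixes F :: "complex \<Rightarrow> complex"
  assumes "F holomorphic_on UNIV"
    and deg: "\<And>k. k \<le> N \<Longrightarrow> degree (c k) \<le> D"
    and nz: "\<exists>k\<in>{1..N}. c k \<noteq> 0"
    and rel: "\<And>s. (\<Sum>k\<le>N. poly (c k) s * F s ^ k) = 0"
  obtains p where "degree p \<le> D" "\<And>s. F s = poly p s"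
proof -
  \<comment> \<open>The true degree of the relation in \<open>F\<close>, at least \<open>1\<close>
    by \<open>nz\<close>.\<close>
  define d where "d = Max {k \<in> {1..N}. c k \<noteq> 0}"
  have "d \<in> {k \<in> {1..N}. c k \<noteq> 0}"
    unfolding d_def using nz by (intro Max_in) auto
  then have d: "1 \<le> d" "d \<le> N" "c d \<noteq> 0" by auto
  have above: "c k = 0" if "d < k" "k \<le> N" for k
  proof (rule ccontr)
    assume "c k \<noteq> 0"
    then have "k \<le> d" unfolding d_def using that by (intro Max_ge) auto
    then show False using that by simp
  qed
  obtain \<delta> R where \<delta>: "\<delta> > 0" "\<And>s. norm s \<ge> R \<Longrightarrow> norm (poly (c d) s) \<ge> \<delta>"
    using poly_lower_bound[OF d(3)] by blast
  define C where "C = (\<Sum>k<d. \<Sum>i\<le>degree (c k). norm (coeff (c k) i))"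
  have C: "C \<ge> 0" unfolding C_def by (intro sum_nonneg) auto
  \<comment> \<open>The summand \<open>1\<close> takes care of the points where
    \<open>norm (F s)\<close> is at most \<open>1\<close>.\<close>
  have bound: "norm (F s) \<le> (1 + C / \<delta>) * norm s ^ D" if "max 1 R \<le> norm s" for s
  proof (cases "norm (F s) \<le> 1")
    case True
    also have "1 \<le> (1 + C / \<delta>) * norm s ^ D"
      using mult_mono[of 1 "1 + C / \<delta>" 1 "norm s ^ D"] C \<delta>(1) that by (simp add: one_le_power)
    finally show ?thesis .
  next
    case False
    have "0 = (\<Sum>k\<le>d. poly (c k) s * F s ^ k)"
      unfolding rel[of s, symmetric] using d above by (intro sum.mono_neutral_right) auto
    also have "\<dots> = (\<Sum>k<d. poly (c k) s * F s ^ k) + poly (c d) s * F s ^ d"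
      using sum.lessThan_Suc[of "\<lambda>k. poly (c k) s * F s ^ k" d] by (simp add: lessThan_Suc_atMost)
    finally have "poly (c d) s * F s ^ d = - (\<Sum>k<d. poly (c k) s * F s ^ k)"
      by (simp add: eq_neg_iff_add_eq_0 add.commute)
    then have "norm (poly (c d) s) * norm (F s) ^ d = norm (\<Sum>k<d. poly (c k) s * F s ^ k)"
      by (metis norm_minus_cancel norm_mult norm_power)
    also have "\<dots> \<le> (\<Sum>k<d. norm (poly (c k) s) * norm (F s) ^ k)"
      by (rule order_trans[OF norm_sum]) (simp add: norm_mult norm_power)
    also have "\<dots> \<le> (\<Sum>k<d. ((\<Sum>i\<le>degree (c k). norm (coeff (c k) i)) * norm s ^ D) * norm (F s) ^ (d - 1))"
      using False that d deg by (intro sum_mono mult_mono poly_upper_bound power_increasing) (auto intro!: mult_nonneg_nonneg sum_nonneg)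
    also have "\<dots> = C * norm s ^ D * norm (F s) ^ (d - 1)"
      by (simp add: C_def sum_distrib_right)
    finally have "(norm (poly (c d) s) * norm (F s)) * norm (F s) ^ (d - 1) \<le> (C * norm s ^ D) * norm (F s) ^ (d - 1)"
      using d(1) by (cases d) (auto simp: mult_ac)
    moreover have "norm (F s) ^ (d - 1) > 0" using False by (intro zero_less_power) linarith
    ultimately have "norm (poly (c d) s) * norm (F s) \<le> C * norm s ^ D" by simp
    moreover have "\<delta> * norm (F s) \<le> norm (poly (c d) s) * norm (F s)"
      using \<delta>(2)[of s] that by (intro mult_right_mono) auto
    ultimately have "norm (F s) \<le> C / \<delta> * norm s ^ D"
      using \<delta>(1) by (simp add: field_simps)
    also have "\<dots> \<le> (1 + C / \<delta>) * norm s ^ D"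
      by (intro mult_right_mono) auto
    finally show ?thesis .
  qed
  define p where "p = (\<Sum>k\<le>D. monom ((deriv ^^ k) F 0 / fact k) k)"
  show ?thesis
  proof (rule that[of p])
    show "degree p \<le> D"
      unfolding p_def by (intro degree_sum_le) (auto intro: order_trans[OF degree_monom_le])
    fix s
    have "F s = (\<Sum>k\<le>D. (deriv ^^ k) F 0 / fact k * s ^ k)"
      by (rule Liouville_polynomial[OF assms(1) bound])
    then show "F s = poly p s" by (simp add: p_def poly_sum poly_monom)
  qed
qed

section \<open>Lagrange interpolation\<close>

lemma lagrange_basis:
  fixes U :: "complex set"
  assumes "finite U"
  obtains l where "\<And>u. u \<in> U \<Longrightarrow> degree (l u) < card U"
    "\<And>u w. u \<in> U \<Longrightarrow> w \<in> U \<Longrightarrow> poly (l u) w = (if u = w then 1 else 0)"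
proof -
  define l where "l = (\<lambda>u. \<Prod>w\<in>U - {u}. Polynomial.smult (1 / (u - w)) [:- w, 1:])"
  show ?thesis
  proof (rule that[of l])
    fix u assume u: "u \<in> U"
    have "degree (l u) \<le> (\<Sum>w\<in>U - {u}. degree (Polynomial.smult (1 / (u - w)) [:- w, 1:]))"
      unfolding l_def using degree_prod_sum_le[of "U - {u}" "\<lambda>w. Polynomial.smult (1 / (u - w)) [:- w, 1:]"] assms
      by (simp add: comp_def)
    also have "\<dots> \<le> (\<Sum>w\<in>U - {u}. 1)"
      by (intro sum_mono order_trans[OF degree_smult_le]) simp
    also have "\<dots> < card U" using u assms card_gt_0_iff[of U] by (auto simp: card_Diff_singleton)
    finally show "degree (l u) < card U" .
    fix w assume "w \<in> U"
    then show "poly (l u) w = (if u = w then 1 else 0)"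
      using assms unfolding l_def poly_prod
      by (auto intro!: prod.neutral simp: diff_divide_distrib[symmetric])
  qed
qed

lemma lagrange_interpolation:
  fixes U :: "complex set"
  assumes "finite U" obtains p where "\<And>u. u \<in> U \<Longrightarrow> poly p u = y u"
proof -
  obtain l where l: "\<And>u w. u \<in> U \<Longrightarrow> w \<in> U \<Longrightarrow> poly (l u) w = (if u = w then 1 else 0)"
    using lagrange_basis[OF assms] by metis
  have "poly (\<Sum>u\<in>U. Polynomial.smult (y u) (l u)) w = y w" if "w \<in> U" for w
  proof -
    have "poly (\<Sum>u\<in>U. Polynomial.smult (y u) (l u)) w = (\<Sum>u\<in>U. if u = w then y w else 0)"
      unfolding poly_sum using l that by (intro sum.cong) auto
    then show ?thesis using that assms by simp
  qed
  then show ?thesis using that by blast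
qed

context keller_map
begin

text \<open>The inverse function theorem used here yields a real derivative of \<open>g\<close>; its
  explicit complex linear form turns it into a complex derivative along each coordinate
  line.\<close>

lemma inverse_field_derivative:
  assumes g: "\<And>z. g (f z) = z" and w: "(u, v) \<in> range f"
  shows "(\<lambda>s. fst (g (s, v)) - t * snd (g (s, v))) field_differentiable (at u)"
    and "(\<lambda>s. fst (g (u, s)) - t * snd (g (u, s))) field_differentiable (at v)"
proof -
  obtain z where z: "f z = (u, v)" using w by auto
  obtain f' g' a b c d where D: "(f has_derivative f') (at z)" "bounded_linear g'" "f' \<circ> g' = id" "g' \<circ> f' = id"
    and g': "\<And>h. g' h = (a * fst h + b * snd h, c * fst h + d * snd h)"
    by (rule derivative[of z], rule that)
  have "(g has_derivative g') (at (f z))"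
    by (rule has_derivative_inverse_strong[OF open_UNIV UNIV_I poly_map2_continuous[OF poly_map] g D(1,3)])
  then have Dg: "(g has_derivative g') (at (u, v))" using z by simp
  have 1: "((\<lambda>s. g (s, v)) has_derivative (\<lambda>h. g' (h, 0))) (at u)"
    by (rule has_derivative_compose[where f = "\<lambda>s. (s, v)" and f' = "\<lambda>h. (h, 0)" and g = g, OF _ Dg])
      (intro has_derivative_Pair has_derivative_ident has_derivative_const)
  have 2: "((\<lambda>s. g (u, s)) has_derivative (\<lambda>h. g' (0, h))) (at v)"
    by (rule has_derivative_compose[where f = "\<lambda>s. (u, s)" and f' = "\<lambda>h. (0, h)" and g = g, OF _ Dg])
      (intro has_derivative_Pair has_derivative_ident has_derivative_const)
  have "((\<lambda>s. fst (g (s, v)) - t * snd (g (s, v))) has_derivative (\<lambda>h. fst (g' (h, 0)) - t * snd (g' (h, 0)))) (at u)"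
    by (intro has_derivative_diff has_derivative_fst has_derivative_snd has_derivative_mult_right 1)
  then have "((\<lambda>s. fst (g (s, v)) - t * snd (g (s, v))) has_field_derivative (a - t * c)) (at u)"
    unfolding has_field_derivative_def
    by (rule has_derivative_eq_rhs) (auto simp: g' algebra_simps fun_eq_iff)
  then show "(\<lambda>s. fst (g (s, v)) - t * snd (g (s, v))) field_differentiable (at u)"
    unfolding field_differentiable_def by blast
  have "((\<lambda>s. fst (g (u, s)) - t * snd (g (u, s))) has_derivative (\<lambda>h. fst (g' (0, h)) - t * snd (g' (0, h)))) (at v)"
    by (intro has_derivative_diff has_derivative_fst has_derivative_snd has_derivative_mult_right 2)
  then have "((\<lambda>s. fst (g (u, s)) - t * snd (g (u, s))) has_field_derivative (b - t * d)) (at v)"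
    unfolding has_field_derivative_def
    by (rule has_derivative_eq_rhs) (auto simp: g' algebra_simps fun_eq_iff)
  then show "(\<lambda>s. fst (g (u, s)) - t * snd (g (u, s))) field_differentiable (at v)"
    unfolding field_differentiable_def by blast
qed

text \<open>The linear form \<open>X\<close> of the inverse is a root of the eliminant. On lines
  missing \<open>E\<close> it is entire and algebraic, hence polynomial, with a uniform degree bound
  on rows. Interpolation between finitely many columns gives one polynomial \<open>p\<close> that
  agrees with \<open>X\<close> on almost all rows.\<close>

lemma inverse_linear_form_poly:
  assumes g: "\<And>z. g (f z) = z"
    and T: "\<And>x u v. tripoly T x u v = 0 \<longleftrightarrow> (\<exists>y. f (x + t * y, y) = (u, v))"
  obtains p where "poly2 p" "\<And>z. p (f z) = fst z - t * snd z"
proof -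
  define X where "X = (\<lambda>u v. fst (g (u, v)) - t * snd (g (u, v)))"
  define E where "E = - range f"
  have E: "finite E" unfolding E_def by (rule finite_compl_range)
  have rel: "(\<Sum>k\<le>degree T. bipoly (coeff T k) u v * X u v ^ k) = 0" if range: "(u, v) \<in> range f" for u v
  proof -
    obtain a b where ab: "f (a, b) = (u, v)" using range by auto
    then have "X u v = a - t * b" unfolding X_def using g by (metis fst_conv snd_conv)
    then have "tripoly T (X u v) u v = 0" using T ab by (metis diff_add_cancel)
    then show ?thesis by (simp add: tripoly_altdef)
  qed
  \<comment> \<open>A bound for the degree in \<open>u\<close> of all coefficients of
    \<open>T\<close>, independent of \<open>v\<close>.\<close>
  define D where "D = Max ((\<lambda>k. Max ((\<lambda>j. degree (coeff (coeff T k) j)) ` {..degree (coeff T k)})) ` {..degree T})"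
  have D: "degree (poly (coeff T k) [:v:]) \<le> D" if "k \<le> degree T" for k v
  proof -
    have "degree (coeff (coeff T k) j) \<le> D" if "j \<le> degree (coeff T k)" for j
    proof -
      have "degree (coeff (coeff T k) j) \<le> Max ((\<lambda>j. degree (coeff (coeff T k) j)) ` {..degree (coeff T k)})"
        using that by (intro Max_ge) auto
      also have "\<dots> \<le> D" unfolding D_def using \<open>k \<le> degree T\<close> by (intro Max_ge) auto
      finally show ?thesis .
    qed
    then show ?thesis unfolding poly_altdef[of "coeff T k"]
      by (intro degree_sum_le) (auto simp: poly_const_pow intro!: order_trans[OF degree_mult_le])
  qed
  have row: "\<exists>p. degree p \<le> D \<and> (\<forall>u. X u v = poly p u)" if "v \<notin> snd ` E" for v
  proof -
    have range: "(u, v) \<in> range f" for u using that unfolding E_def by force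
    have hol: "(\<lambda>u. X u v) holomorphic_on UNIV"
      unfolding holomorphic_on_def X_def
      using inverse_field_derivative(1)[OF g range] by (simp add: field_differentiable_at_within)
    have nz: "\<exists>k\<in>{1..degree T}. poly (coeff T k) [:v:] \<noteq> 0"
    proof -
      \<comment> \<open>Any point of the row lies in the image and so provides a nonvanishing
        coefficient of positive degree.\<close>
      obtain k where "k \<in> {1..degree T}" "bipoly (coeff T k) 0 v \<noteq> 0"
        using range[of 0] unfolding range_iff_eliminant_coeff[OF T] by blast
      then show ?thesis by (intro bexI[of _ k]) (auto simp: bipoly_def)
    qed
    have rel0: "(\<Sum>k\<le>degree T. poly (poly (coeff T k) [:v:]) u * X u v ^ k) = 0" for u
      using rel[OF range] by (simp add: bipoly_def)
    obtain p where "degree p \<le> D" "\<And>u. X u v = poly p u"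
      by (rule entire_algebraic_imp_poly[OF hol D nz rel0]) auto
    then show ?thesis by blast
  qed
  have column: "\<exists>p. \<forall>v. X u v = poly p v" if "u \<notin> fst ` E" for u
  proof -
    have range: "(u, v) \<in> range f" for v using that unfolding E_def by force
    define c where "c = (\<lambda>k. map_poly (\<lambda>a. poly a u) (coeff T k))"
    have hol: "(\<lambda>v. X u v) holomorphic_on UNIV"
      unfolding holomorphic_on_def X_def
      using inverse_field_derivative(2)[OF g range] by (simp add: field_differentiable_at_within)
    have nz: "\<exists>k\<in>{1..degree T}. c k \<noteq> 0"
    proof -
      obtain k where k: "k \<in> {1..degree T}" "bipoly (coeff T k) u 0 \<noteq> 0"
        using range[of 0] unfolding range_iff_eliminant_coeff[OF T] by blast
      then have "poly (c k) 0 \<noteq> 0" unfolding c_def poly_map_poly_eval by simp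
      then have "c k \<noteq> 0" by (metis poly_0)
      then show ?thesis using k(1) by blast
    qed
    have rel0: "(\<Sum>k\<le>degree T. poly (c k) v * X u v ^ k) = 0" for v
      using rel[OF range] by (simp add: c_def poly_map_poly_eval)
    have deg: "degree (c k) \<le> Max ((\<lambda>k. degree (c k)) ` {..degree T})" if "k \<le> degree T" for k
      using that by (intro Max_ge) auto
    obtain p where "\<And>v. X u v = poly p v"
      by (rule entire_algebraic_imp_poly[OF hol deg nz rel0]) auto
    then show ?thesis by blast
  qed
  have "infinite (- fst ` E)" using E by (simp add: finite_compl infinite_UNIV_char_0)
  \<comment> \<open>\<open>D + 1\<close> columns determine a polynomial of degree at most
    \<open>D\<close> on each row.\<close>
  then obtain U where U: "finite U" "card U = Suc D" "U \<subseteq> - fst ` E"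
    using infinite_arbitrarily_large by blast
  then obtain b where b: "\<And>u v. u \<in> U \<Longrightarrow> X u v = poly (b u) v"
    using column by (metis ComplD subsetD)
  obtain l where l: "\<And>u. u \<in> U \<Longrightarrow> degree (l u) < card U"
    "\<And>u w. u \<in> U \<Longrightarrow> w \<in> U \<Longrightarrow> poly (l u) w = (if u = w then 1 else 0)"
    using lagrange_basis[OF U(1)] by metis
  define p where "p = (\<lambda>w::complex\<times>complex. \<Sum>u\<in>U. poly (b u) (snd w) * poly (l u) (fst w))"
  have pX: "p (u, v) = X u v" if v: "v \<notin> snd ` E" for u v
  proof -
    obtain q where q: "degree q \<le> D" "\<And>u. X u v = poly q u" using row[OF v] by blast
    define q' where "q' = (\<Sum>u\<in>U. Polynomial.smult (poly (b u) v) (l u))"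
    have "degree q' \<le> D"
      unfolding q'_def using l(1) U by (intro degree_sum_le) (auto intro!: order_trans[OF degree_smult_le] simp: less_Suc_eq_le)
    moreover have "poly q' w = poly q w" if "w \<in> U" for w
    proof -
      have "poly q' w = (\<Sum>u\<in>U. if u = w then poly (b w) v else 0)"
        unfolding q'_def poly_sum using l(2) that by (intro sum.cong) auto
      also have "\<dots> = poly (b w) v" using that U(1) by simp
      also have "\<dots> = poly q w" using b[OF that, of v] q(2)[of w] by simp
      finally show ?thesis .
    qed
    ultimately have "q' = q"
      using q(1) U by (intro poly_eqI_degree[of U]) auto
    moreover have "p (u, v) = poly q' u" by (simp add: p_def q'_def poly_sum)
    ultimately show ?thesis using q(2) by simp
  qed
  have p2: "poly2 p"
    unfolding p_def by (induction U rule: infinite_finite_induct) (auto intro!: poly2_add poly2_mult poly2_poly)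
  \<comment> \<open>The points mapped to good rows form a nonempty open set, from which the identity
    for \<open>p\<close> spreads to all \<open>z\<close>.\<close>
  define V where "V = {z. snd (f z) \<notin> snd ` E}"
  have "open V"
  proof -
    have "open (- snd ` E)" using E by (simp add: finite_imp_closed open_Compl)
    moreover have "continuous_on UNIV (\<lambda>z. snd (f z))"
      using poly_map2_continuous[OF poly_map] by (rule continuous_on_snd)
    ultimately have "open ((\<lambda>z. snd (f z)) -` (- snd ` E))" by (rule open_vimage)
    then show ?thesis by (simp add: V_def vimage_def)
  qed
  moreover have "V \<noteq> {}"
  proof -
    obtain v where v: "v \<notin> snd ` E"
      using E ex_new_if_finite[of "snd ` E"] infinite_UNIV_char_0 by blast
    then have "(0, v) \<in> range f" unfolding E_def by force
    then obtain z where "f z = (0, v)" by auto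
    then have "z \<in> V" using v by (simp add: V_def)
    then show ?thesis by blast
  qed
  moreover have "p (f z) = fst z - t * snd z" if "z \<in> V" for z
  proof -
    have "p (f z) = X (fst (f z)) (snd (f z))" using pX[of "snd (f z)" "fst (f z)"] that by (simp add: V_def)
    then show ?thesis by (simp add: X_def g)
  qed
  moreover have "poly2 (\<lambda>z. p (f z))"
    using poly2_compose[OF p2, of "\<lambda>z. fst (f z)" "\<lambda>z. snd (f z)"] poly_map
    unfolding poly_map2_def by simp
  moreover have "poly2 (\<lambda>z. fst z - t * snd z)"
    by (intro poly2_diff poly2_mult poly2_fst poly2_snd poly2_const)
  ultimately have "p (f z) = fst z - t * snd z" for z
    using poly2_eq_open[of "\<lambda>z. p (f z)" "\<lambda>z. fst z - t * snd z" V] by blast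
  then show ?thesis using that p2 by blast
qed

text \<open>Two shear parameters give two independent linear forms of the inverse as polynomials;
  solving the linear system yields both coordinates.\<close>

lemma inj_imp_polynomial_inverse:
  assumes "inj f"
  shows "bij f \<and> (\<exists>g. poly_map2 g \<and> (\<forall>z. g (f z) = z) \<and> (\<forall>z. f (g z) = z))"
proof -
  obtain S where S: "finite S" 
    "\<And>t. t \<notin> S \<Longrightarrow> \<exists>T. \<forall>x u v. tripoly T x u v = 0 \<longleftrightarrow> (\<exists>y. f (x + t * y, y) = (u, v))"
    by (rule eliminant) auto
  have lin: "\<exists>p. poly2 p \<and> (\<forall>z. p (f z) = fst z - t * snd z)" if t: "t \<notin> S" for t
  proof -
    obtain T where T: "\<And>x u v. tripoly T x u v = 0 \<longleftrightarrow> (\<exists>y. f (x + t * y, y) = (u, v))"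
      using S(2)[OF t] by blast
    have "the_inv f (f z) = z" for z using assms by (rule the_inv_f_f)
    from inverse_linear_form_poly[of "the_inv f" T t, OF this T]
    obtain p where "poly2 p" "\<And>z. p (f z) = fst z - t * snd z" by blast
    then show ?thesis by blast
  qed
  obtain t where t: "t \<notin> S" using S(1) ex_new_if_finite infinite_UNIV_char_0 by blast
  obtain t' where t': "t' \<notin> insert t S"
    using S(1) ex_new_if_finite[of "insert t S"] infinite_UNIV_char_0 by blast
  obtain p p' where p: "poly2 p" "\<And>z. p (f z) = fst z - t * snd z"
    and p': "poly2 p'" "\<And>z. p' (f z) = fst z - t' * snd z"
    using lin[of t] lin[of t'] t t' by auto
  \<comment> \<open>The two forms differ by \<open>(t' - t)\<close> times the second
    coordinate.\<close>
  define h where "h = (\<lambda>w. (p w - p' w) * (1 / (t' - t)))"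
  define g where "g = (\<lambda>w. (p w + t * h w, h w))"
  have "h (f z) = snd z" for z
    using t' by (simp add: h_def p p' field_simps)
  then have gf: "g (f z) = z" for z by (simp add: g_def p)
  have "poly2 h" unfolding h_def using p(1) p'(1) by (intro poly2_mult poly2_diff poly2_const)
  then have g2: "poly_map2 g"
    unfolding poly_map2_def g_def using p(1) by (auto intro!: poly2_add poly2_mult)
  \<comment> \<open>On the image this follows from \<open>gf\<close>. The image is open, so the
    polynomial identity holds everywhere, which also gives surjectivity.\<close>
  have fg: "f (g w) = w" for w
  proof -
    have "poly_map2 (\<lambda>w. f (g w))" using poly_map g2 by (rule poly_map2_compose)
    then have 2: "poly2 (\<lambda>w. fst (f (g w)))" "poly2 (\<lambda>w. snd (f (g w)))"
      unfolding poly_map2_def by auto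
    have r: "open (range f)" "range f \<noteq> {}" using open_map[OF open_UNIV] by auto
    have "fst (f (g w)) = fst w"
      by (rule poly2_eq_open[OF 2(1) poly2_fst r]) (auto simp: gf)
    moreover have "snd (f (g w)) = snd w"
      by (rule poly2_eq_open[OF 2(2) poly2_snd r]) (auto simp: gf)
    ultimately show ?thesis by (rule prod_eqI)
  qed
  have "bij f" using gf fg by (intro o_bij[of g f]) (auto simp: fun_eq_iff)
  then show ?thesis using g2 gf fg by blast
qed

end

section \<open>Non-injective maps\<close>

definition shear_fst :: "complex poly \<Rightarrow> complex \<times> complex \<Rightarrow> complex \<times> complex" where
  "shear_fst a w = (fst w + poly a (snd w), snd w)"

definition shear_snd :: "complex poly \<Rightarrow> complex \<times> complex \<Rightarrow> complex \<times> complex" where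
  "shear_snd a w = (fst w, snd w + poly a (fst w))"

lemma bij_shear: "bij (shear_fst a)" "bij (shear_snd a)"
proof -
  have "shear_fst (- a) \<circ> shear_fst a = id" "shear_fst a \<circ> shear_fst (- a) = id"
    "shear_snd (- a) \<circ> shear_snd a = id" "shear_snd a \<circ> shear_snd (- a) = id"
    by (auto simp: fun_eq_iff shear_fst_def shear_snd_def)
  then show "bij (shear_fst a)" "bij (shear_snd a)" using o_bij by blast+
qed

text \<open>The first shear makes the first coordinates distinct. The second can then prescribe
  distinct second coordinates in \<open>B\<close>, and the third uses these to move every first
  coordinate to \<open>\<alpha>\<close>.\<close>

lemma shears_move_to_vertical_line:
  assumes "finite E" "finite B" "card B = card E"
  obtains a b c where "(shear_fst a \<circ> shear_snd b \<circ> shear_fst c) ` E = {\<alpha>} \<times> B"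
proof -
  \<comment> \<open>The values of \<open>t\<close> at which two points acquire equal first
    coordinates. Pairs with equal second coordinates contribute only the default value
    \<open>0\<close> of division by zero.\<close>
  define bad where "bad = (\<lambda>(z, w). (fst z - fst w) / (snd w - snd z)) ` (E \<times> E)"
  have "finite bad" using assms by (simp add: bad_def)
  then obtain t where t: "t \<notin> bad" using ex_new_if_finite infinite_UNIV_char_0 by blast
  define c where "c = [:0, t:]"
  define E1 where "E1 = shear_fst c ` E"
  have "inj_on (\<lambda>z. fst (shear_fst c z)) E"
  proof (rule inj_onI)
    fix z w assume zw: "z \<in> E" "w \<in> E" "fst (shear_fst c z) = fst (shear_fst c w)"
    then have eq: "fst z - fst w = t * (snd w - snd z)"
      by (simp add: shear_fst_def c_def algebra_simps)
    have "snd w = snd z"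
    proof (rule ccontr)
      assume "snd w \<noteq> snd z"
      then have "t = (fst z - fst w) / (snd w - snd z)" using eq by (simp add: field_simps)
      then show False using t zw unfolding bad_def by force
    qed
    then show "z = w" using eq by (simp add: prod_eq_iff)
  qed
  then have inj1: "inj_on fst E1" and card1: "card (fst ` E1) = card E"
    unfolding E1_def by (auto simp: inj_on_def image_image card_image)
  have fin1: "finite (fst ` E1)" using assms by (simp add: E1_def)
  obtain \<beta> where \<beta>: "bij_betw \<beta> (fst ` E1) B"
    using finite_same_card_bij[OF fin1 assms(2)] card1 assms(3) by auto
  define y where "y = (\<lambda>x. snd (the_inv_into E1 fst x))"
  have y: "y (fst z) = snd z" if "z \<in> E1" for z
    unfolding y_def using the_inv_into_f_f[OF inj1 that] by simp
  obtain b where b: "\<And>x. x \<in> fst ` E1 \<Longrightarrow> poly b x = \<beta> x - y x"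
    by (rule lagrange_interpolation[OF fin1, of "\<lambda>x. \<beta> x - y x"], rule that)
  obtain a where a: "\<And>s. s \<in> B \<Longrightarrow> poly a s = \<alpha> - the_inv_into (fst ` E1) \<beta> s"
    by (rule lagrange_interpolation[OF assms(2), of "\<lambda>s. \<alpha> - the_inv_into (fst ` E1) \<beta> s"], rule that)
  have "shear_fst a (shear_snd b z) = (\<alpha>, \<beta> (fst z))" if z: "z \<in> E1" for z
  proof -
    have "\<beta> (fst z) \<in> B" using \<beta> z bij_betwE by blast
    moreover have "the_inv_into (fst ` E1) \<beta> (\<beta> (fst z)) = fst z"
      using \<beta> z by (intro the_inv_into_f_f) (auto simp: bij_betw_def)
    ultimately show ?thesis
      using z a b y by (simp add: shear_fst_def shear_snd_def)
  qed
  then have "(\<lambda>z. shear_fst a (shear_snd b z)) ` E1 = (\<lambda>z. (\<alpha>, \<beta> (fst z))) ` E1" by simp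
  also have "\<dots> = {\<alpha>} \<times> \<beta> ` (fst ` E1)" by auto
  also have "\<beta> ` (fst ` E1) = B" using \<beta> by (rule bij_betw_imp_surj_on)
  finally have "(shear_fst a \<circ> shear_snd b \<circ> shear_fst c) ` E = {\<alpha>} \<times> B"
    unfolding E1_def by (simp add: image_image comp_def)
  then show ?thesis by (rule that)
qed

context keller_map
begin

text \<open>By the chain rule a multiple of the second row of the Jacobian matrix is added to the
  first, so the determinant is unchanged.\<close>

lemma keller_map_shear_fst: "keller_map (\<lambda>z. shear_fst a (f z))"
proof
  have p: "poly2 (\<lambda>z. fst (f z))" "poly2 (\<lambda>z. snd (f z))"
    using poly_map unfolding poly_map2_def by auto
  then show "poly_map2 (\<lambda>z. shear_fst a (f z))"
    unfolding poly_map2_def shear_fst_def by (auto intro!: poly2_add poly2_poly)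
  have "jacobian_det2 (\<lambda>z. shear_fst a (f z)) x y = jacobian_det2 f x y" for x y
  proof -
    note d = poly2_partial_derivatives[OF p(1)] poly2_partial_derivatives[OF p(2)]
    have "deriv (\<lambda>t. fst (f (t, y)) + poly a (snd (f (t, y)))) x =
        deriv (\<lambda>t. fst (f (t, y))) x + poly (pderiv a) (snd (f (x, y))) * deriv (\<lambda>t. snd (f (t, y))) x"
      by (intro DERIV_imp_deriv DERIV_add DERIV_chain2[OF poly_DERIV] d)
    moreover have "deriv (\<lambda>t. fst (f (x, t)) + poly a (snd (f (x, t)))) y =
        deriv (\<lambda>t. fst (f (x, t))) y + poly (pderiv a) (snd (f (x, y))) * deriv (\<lambda>t. snd (f (x, t))) y"
      by (intro DERIV_imp_deriv DERIV_add DERIV_chain2[OF poly_DERIV] d)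
    ultimately show ?thesis
      unfolding jacobian_det2_def shear_fst_def by (simp add: algebra_simps)
  qed
  then show "const_nonzero_jacobian2 (\<lambda>z. shear_fst a (f z))"
    using jacobian unfolding const_nonzero_jacobian2_def by simp
qed

lemma keller_map_shear_snd: "keller_map (\<lambda>z. shear_snd a (f z))"
proof
  have p: "poly2 (\<lambda>z. fst (f z))" "poly2 (\<lambda>z. snd (f z))"
    using poly_map unfolding poly_map2_def by auto
  then show "poly_map2 (\<lambda>z. shear_snd a (f z))"
    unfolding poly_map2_def shear_snd_def by (auto intro!: poly2_add poly2_poly)
  have "jacobian_det2 (\<lambda>z. shear_snd a (f z)) x y = jacobian_det2 f x y" for x y
  proof -
    note d = poly2_partial_derivatives[OF p(1)] poly2_partial_derivatives[OF p(2)]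
    have "deriv (\<lambda>t. snd (f (t, y)) + poly a (fst (f (t, y)))) x =
        deriv (\<lambda>t. snd (f (t, y))) x + poly (pderiv a) (fst (f (x, y))) * deriv (\<lambda>t. fst (f (t, y))) x"
      by (intro DERIV_imp_deriv DERIV_add DERIV_chain2[OF poly_DERIV] d)
    moreover have "deriv (\<lambda>t. snd (f (x, t)) + poly a (fst (f (x, t)))) y =
        deriv (\<lambda>t. snd (f (x, t))) y + poly (pderiv a) (fst (f (x, y))) * deriv (\<lambda>t. fst (f (x, t))) y"
      by (intro DERIV_imp_deriv DERIV_add DERIV_chain2[OF poly_DERIV] d)
    ultimately show ?thesis
      unfolding jacobian_det2_def shear_snd_def by (simp add: algebra_simps)
  qed
  then show "const_nonzero_jacobian2 (\<lambda>z. shear_snd a (f z))"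
    using jacobian unfolding const_nonzero_jacobian2_def by simp
qed

text \<open>Each point of \<open>S\<close> shares its value with a point outside \<open>S\<close>,
  so \<open>f\<close> maps \<open>- S\<close> onto its full range \<open>- E\<close>. Since
  \<open>\<phi>\<close> carries \<open>E\<close> to \<open>S\<close>, it carries this range to
  \<open>- S\<close>.\<close>

lemma not_inj_counterexample:
  assumes "\<not> inj f"
  obtains F \<Omega> where "keller_map F" "finite (- \<Omega>)" "F ` \<Omega> = \<Omega>" "\<not> inj_on F \<Omega>"
proof -
  obtain z1 z2 where z12: "f z1 = f z2" "z1 \<noteq> z2" using assms by (auto simp: inj_def)
  obtain U V where UV: "open U" "open V" "z1 \<in> U" "z2 \<in> V" "U \<inter> V = {}"
    using hausdorff[OF z12(2)] by blast
  \<comment> \<open>A neighbourhood of \<open>z1\<close> in which every point has a partner in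
    \<open>V\<close> with the same value, necessarily outside \<open>W\<close>.\<close>
  define W where "W = U \<inter> f -` (f ` V)"
  have "open W"
    unfolding W_def using UV open_map poly_map2_continuous[OF poly_map, of UNIV]
    by (intro open_Int open_vimage) auto
  moreover have "z1 \<in> W" unfolding W_def using UV z12 by auto
  ultimately obtain A B where AB: "open A" "open B" "z1 \<in> A \<times> B" "A \<times> B \<subseteq> W"
    by (rule open_prod_elim)
  have partner: "\<exists>w\<in>V. f w = f z" if "z \<in> W" for z using that unfolding W_def by force
  define E where "E = - range f"
  have E: "finite E" unfolding E_def by (rule finite_compl_range)
  define \<alpha> where "\<alpha> = fst z1"
  have "infinite B" using AB(2,3) finite_imp_not_open by auto
  \<comment> \<open>One point more than \<open>E\<close> has: \<open>s0\<close> stays outside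
    \<open>S\<close>, so that \<open>(\<alpha>, s0)\<close> and its partner witness non-injectivity
    on \<open>- S\<close>.\<close>
  then obtain B1 where B1: "finite B1" "card B1 = Suc (card E)" "B1 \<subseteq> B"
    using infinite_arbitrarily_large by blast
  then obtain s0 B0 where B0: "B1 = insert s0 B0" "s0 \<notin> B0" "card B0 = card E"
    by (auto simp: card_Suc_eq)
  have finB0: "finite B0" using B0 B1 by simp
  define S where "S = {\<alpha>} \<times> B0"
  have S: "S \<subseteq> W" "finite S" "(\<alpha>, s0) \<in> W" "(\<alpha>, s0) \<notin> S"
    using AB B1 B0 finB0 unfolding S_def \<alpha>_def by auto
  obtain a b c where abc: "(shear_fst a \<circ> shear_snd b \<circ> shear_fst c) ` E = S"
    unfolding S_def by (rule shears_move_to_vertical_line[OF E finB0 B0(3)])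
  define \<phi> where "\<phi> = shear_fst a \<circ> shear_snd b \<circ> shear_fst c"
  have \<phi>: "bij \<phi>" unfolding \<phi>_def by (intro bij_comp bij_shear)
  define F where "F = (\<lambda>z. \<phi> (f z))"
  have "keller_map F"
    unfolding F_def \<phi>_def comp_def
    by (intro keller_map.keller_map_shear_fst keller_map.keller_map_shear_snd keller_map_shear_fst)
  moreover have "F ` (- S) = - S"
  proof -
    have "f ` (- S) = range f"
    proof
      show "range f \<subseteq> f ` (- S)"
      proof
        fix w assume "w \<in> range f"
        then obtain z where z: "w = f z" by auto
        have "f z \<in> f ` (- S)"
        proof (cases "z \<in> S")
          case True
          then obtain w where w: "w \<in> V" "f w = f z" using partner S(1) by blast
          then have "w \<notin> S" using S(1) UV(5) unfolding W_def by auto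
          then show ?thesis using w(2) by (metis ComplI imageI)
        qed auto
        then show "w \<in> f ` (- S)" using z by simp
      qed
    qed auto
    then have "F ` (- S) = \<phi> ` (- E)" unfolding F_def E_def by (metis double_complement image_image)
    also have "\<dots> = - S" using \<phi> abc unfolding \<phi>_def by (metis bij_image_Compl_eq)
    finally show ?thesis .
  qed
  moreover have "\<not> inj_on F (- S)"
  proof
    assume inj: "inj_on F (- S)"
    obtain w where w: "w \<in> V" "f w = f (\<alpha>, s0)" using partner S(3) by blast
    have "w \<notin> S" "w \<noteq> (\<alpha>, s0)" using w(1) S UV(5) unfolding W_def by auto
    moreover have "F w = F (\<alpha>, s0)" using w(2) by (simp add: F_def)
    ultimately show False using inj S(4) by (auto dest: inj_onD)
  qed
  ultimately show ?thesis using that[of F "- S"] S(2) by simp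
qed

end

theorem theorem2:
  shows "(\<forall>f. poly_map2 f \<and> const_nonzero_jacobian2 f \<longrightarrow>
            bij f \<and> (\<exists>g. poly_map2 g \<and> (\<forall>z. g (f z) = z) \<and> (\<forall>z. f (g z) = z)))
     \<longleftrightarrow>
         (\<forall>f \<Omega>. poly_map2 f \<and> const_nonzero_jacobian2 f \<and> cofinite2 \<Omega> \<and> f ` \<Omega> = \<Omega>
            \<longrightarrow> inj_on f \<Omega>)"
  (is "?A \<longleftrightarrow> ?B")
proof
  assume ?A
  then show ?B by (meson bij_is_inj inj_on_subset subset_UNIV)
next
  assume B: ?B
  show ?A
  proof (intro allI impI)
    fix f assume "poly_map2 f \<and> const_nonzero_jacobian2 f"
    then interpret keller_map f by unfold_locales auto
    have "inj f"
    proof (rule ccontr)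
      assume "\<not> inj f"
      then obtain F \<Omega> where F: "keller_map F" "finite (- \<Omega>)" "F ` \<Omega> = \<Omega>" "\<not> inj_on F \<Omega>"
        by (rule not_inj_counterexample)
      then have "cofinite2 \<Omega>" by (simp add: cofinite2_def Compl_eq_Diff_UNIV)
      then show False using B F unfolding keller_map_def by blast
    qed
    then show "bij f \<and> (\<exists>g. poly_map2 g \<and> (\<forall>z. g (f z) = z) \<and> (\<forall>z. f (g z) = z))"
      by (rule inj_imp_polynomial_inverse)
  qed
qed

end
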